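(* Let $d\geqslant 3$, let $q$ be an odd prime power, let $\Sigma$ be the dual polar graph on $[C_{d-1}(q)]$ with vertex set $V\Sigma$, and let $\Gamma=\mathrm{Hem}_d(q)$ be the Hemmeter graph. Let $Y$ be a nontrivial descendent of $\Gamma$ (with respect to the standard $Q$-polynomial ordering) with width $w$ and dual width $w^*=d-w$. If $w=1$ then $Y$ is an edge (the two endpoints of an edge of $\Gamma$). If $w>1$ then there is an isotropic subspace $u$ of $[C_{d-1}(q)]$ with $\dim u=w^*$ such that $Y=\{x^+,x^-:x\in V\Sigma,\ u\subseteq x\}$.
   Context: All graphs are finite, simple and undirected. Let $\Gamma$ be a connected graph with vertex set $X$, path-length distance $\partial$ and diameter $d$; let $A_i\in\mathbb{C}^{X\times X}$ be the adjacency matrix of the distance-$i$ graph ($A_0=I$). $\Gamma$ is distance-regular if there are integers $b_i,c_i$ such that whenever $\partial(x,y)=i$, $y$ has exactly $b_i$ (resp. $c_i$) neighbours at distance $i+1$ (resp. $i-1$) from $x$. Then the Bose--Mesner algebra $\langle A_0,\dots,A_d\rangle$ (complex span) is a commutative semisimple algebra with a basis of primitive idempotents $E_0=|X|^{-1}J,E_1,\dots,E_d$. $\Gamma$ is $Q$-polynomial with respect to the ordering $\{E_i\}_{i=0}^d$ if there are scalars $a_i^*,b_i^*,c_i^*$ with $b_d^*=c_0^*=0$, $b_{i-1}^*c_i^*\neq 0$ $(1\leqslant i\leqslant d)$ and $E_1\circ E_i=|X|^{-1}(b_{i-1}^*E_{i-1}+a_i^*E_i+c_{i+1}^*E_{i+1})$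 $(0\leqslant i\leqslant d)$, where $\circ$ is the entrywise product, $E_{-1}=E_{d+1}=0$, $b_{-1}^*=c_{d+1}^*=0$. Write $|X|E_1=\sum_{i=0}^d\theta_i^*A_i$. For a nonempty $Y\subseteq X$ with characteristic vector $\hat Y$, the width is $w=\max\{i:\hat Y^{\mathsf T}A_i\hat Y\neq 0\}$ and the dual width is $w^*=\max\{i:\hat Y^{\mathsf T}E_i\hat Y\neq 0\}$. One always has $w+w^*\geqslant d$; $Y$ is a descendent of $\Gamma$ if $w+w^*=d$; it is trivial if moreover $w=0$ or $w=d$ (a singleton or $X$), nontrivial otherwise. Put $[i]_q=1+q+\dots+q^{i-1}$. $\Gamma$ has classical parameters $(d,q,\alpha,\beta)$ if $b_i=([d]_q-[i]_q)(\beta-\alpha[i]_q)$ and $c_i=[i]_q(1+\alpha[i-1]_q)$ for $0\leqslant i\leqslant d$. Then $\Gamma$ has a $Q$-polynomial ordering, called standard, for which $\theta_i^*=\xi^*[d-i]_q+\zeta^*$ for some scalars $\xi^*\neq 0$, $\zeta^*$. $[C_{d-1}(q)]$ is the space $\mathbb{F}_q^{2d-2}$ with a nondegenerate alternating form; a subspace is isotropic if the form vanishes identically on it. The vertices of $\Sigma$ are the maximal isotropic subspaces (dimension $d-1$), adjacent when their intersection has dimension $d-2$. $\mathrm{Hem}_d(q)$ is the extended bipartite double of $\Sigma$: its vertex set is $X=X^+\cup X^-$ with $X^{\pm}=\{x^{\pm}:x\in V\Sigma\}$ two disjoint copies of $V\Sigma$, and its edges are the pairs $\{x^+,y^-\}$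 with $x=y$ or $x,y$ adjacent in $\Sigma$. It is distance-regular with diameter $d$ and classical parameters $(d,q,0,1)$. *)

theory Defs
  imports "HOL-Analysis.Analysis"
begin

text \<open>
  A graph is given by a vertex set \<open>V\<close> and an adjacency predicate \<open>adj\<close>, and a complex matrix
  with rows and columns indexed by \<open>V\<close> by a function \<open>'v \<Rightarrow> 'v \<Rightarrow> complex\<close> that vanishes
  outside \<open>V \<times> V\<close>.
\<close>

type_synonym 'v cmat = "'v \<Rightarrow> 'v \<Rightarrow> complex"

definition simple_graph :: "'v set \<Rightarrow> ('v \<Rightarrow> 'v \<Rightarrow> bool) \<Rightarrow> bool" where
  "simple_graph V adj \<longleftrightarrow>
     finite V \<and> (\<forall>x y. adj x y \<longrightarrow> x \<in> V \<and> y \<in> V \<and> x \<noteq> y \<and> adj y x)"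

definition connected_graph :: "'v set \<Rightarrow> ('v \<Rightarrow> 'v \<Rightarrow> bool) \<Rightarrow> bool" where
  "connected_graph V adj \<longleftrightarrow> V \<noteq> {} \<and> (\<forall>x\<in>V. \<forall>y\<in>V. adj\<^sup>*\<^sup>* x y)"

definition graph_dist :: "('v \<Rightarrow> 'v \<Rightarrow> bool) \<Rightarrow> 'v \<Rightarrow> 'v \<Rightarrow> nat" where
  "graph_dist adj x y = (LEAST n. (adj ^^ n) x y)"

definition graph_diameter :: "'v set \<Rightarrow> ('v \<Rightarrow> 'v \<Rightarrow> bool) \<Rightarrow> nat" where
  "graph_diameter V adj = Max {graph_dist adj x y | x y. x \<in> V \<and> y \<in> V}"

definition intersection_numbers ::
    "'v set \<Rightarrow> ('v \<Rightarrow> 'v \<Rightarrow> bool) \<Rightarrow> (nat \<Rightarrow> nat) \<Rightarrow> (nat \<Rightarrow> nat) \<Rightarrow> bool" where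
  "intersection_numbers V adj b c \<longleftrightarrow>
     (\<forall>i. \<forall>x\<in>V. \<forall>y\<in>V. graph_dist adj x y = i \<longrightarrow>
        card {z\<in>V. adj y z \<and> graph_dist adj x z = i + 1} = b i \<and>
        card {z\<in>V. adj y z \<and> graph_dist adj x z + 1 = i} = c i)"

definition distance_regular :: "'v set \<Rightarrow> ('v \<Rightarrow> 'v \<Rightarrow> bool) \<Rightarrow> bool" where
  "distance_regular V adj \<longleftrightarrow>
     simple_graph V adj \<and> connected_graph V adj \<and> (\<exists>b c. intersection_numbers V adj b c)"

subsection \<open>The Bose-Mesner algebra\<close>

definition dist_mat :: "'v set \<Rightarrow> ('v \<Rightarrow> 'v \<Rightarrow> bool) \<Rightarrow> nat \<Rightarrow> 'v cmat" where
  "dist_mat V adj i = (\<lambda>x y. if x \<in> V \<and> y \<in> V \<and> graph_dist adj x y = i then 1 else 0)"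

definition mat_mult :: "'v set \<Rightarrow> 'v cmat \<Rightarrow> 'v cmat \<Rightarrow> 'v cmat" where
  "mat_mult V M N = (\<lambda>x y. \<Sum>z\<in>V. M x z * N z y)"

definition bose_mesner :: "'v set \<Rightarrow> ('v \<Rightarrow> 'v \<Rightarrow> bool) \<Rightarrow> 'v cmat set" where
  "bose_mesner V adj =
     {M. \<exists>k. M = (\<lambda>x y. \<Sum>i\<le>graph_diameter V adj. k i * dist_mat V adj i x y)}"

definition nonzero_idempotent :: "'v set \<Rightarrow> 'v cmat \<Rightarrow> bool" where
  "nonzero_idempotent V M \<longleftrightarrow> M \<noteq> (\<lambda>x y. 0) \<and> mat_mult V M M = M"

definition primitive_idempotents :: "'v set \<Rightarrow> ('v \<Rightarrow> 'v \<Rightarrow> bool) \<Rightarrow> 'v cmat set" where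
  "primitive_idempotents V adj =
     {M \<in> bose_mesner V adj. nonzero_idempotent V M \<and>
        \<not> (\<exists>F\<in>bose_mesner V adj. \<exists>G\<in>bose_mesner V adj.
             nonzero_idempotent V F \<and> nonzero_idempotent V G \<and>
             mat_mult V F G = (\<lambda>x y. 0) \<and> mat_mult V G F = (\<lambda>x y. 0) \<and>
             M = (\<lambda>x y. F x y + G x y))}"

subsection \<open>Q-polynomial orderings\<close>

definition Q_polynomial ::
    "'v set \<Rightarrow> ('v \<Rightarrow> 'v \<Rightarrow> bool) \<Rightarrow> (nat \<Rightarrow> 'v cmat) \<Rightarrow> bool" where
  "Q_polynomial V adj E \<longleftrightarrow>
     distance_regular V adj \<and>
     bij_betw E {..graph_diameter V adj} (primitive_idempotents V adj) \<and>
     E 0 = (\<lambda>x y. if x \<in> V \<and> y \<in> V then 1 / of_nat (card V) else 0) \<and>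
     (\<exists>a b c :: nat \<Rightarrow> complex. 
        b (graph_diameter V adj) = 0 \<and> c 0 = 0 \<and>
        (\<forall>i\<in>{1..graph_diameter V adj}. b (i - 1) * c i \<noteq> 0) \<and>
        (\<forall>i\<le>graph_diameter V adj. \<forall>x\<in>V. \<forall>y\<in>V.
           E 1 x y * E i x y = 1 / of_nat (card V) *
             ((if i = 0 then 0 else b (i - 1) * E (i - 1) x y) +
              a i * E i x y +
              (if i = graph_diameter V adj then 0 else c (i + 1) * E (i + 1) x y))))"

definition qint :: "real \<Rightarrow> nat \<Rightarrow> real" where
  "qint q i = (\<Sum>j<i. q ^ j)"

text \<open>At \<open>i = 0\<close> the truncated \<open>i - 1\<close> is harmless, since \<open>qint q 0 = 0\<close> makes the product vanish.\<close>

definition classical_parameters ::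
    "'v set \<Rightarrow> ('v \<Rightarrow> 'v \<Rightarrow> bool) \<Rightarrow> nat \<Rightarrow> real \<Rightarrow> real \<Rightarrow> real \<Rightarrow> bool" where
  "classical_parameters V adj d q \<alpha> \<beta> \<longleftrightarrow>
     distance_regular V adj \<and> graph_diameter V adj = d \<and>
     (\<exists>b c. intersection_numbers V adj b c \<and>
        (\<forall>i\<le>d. real (b i) = (qint q d - qint q i) * (\<beta> - \<alpha> * qint q i) \<and>
               real (c i) = qint q i * (1 + \<alpha> * qint q (i - 1))))"

text \<open>
  The dual eigenvalues are the scalars \<open>\<theta> i\<close> below. For given classical parameters the standard
  ordering is unique: by linear independence of the primitive idempotents at most one of them
  other than \<open>E 0\<close> has dual eigenvalues of the required form, and \<open>E 1\<close> determines the ordering.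
\<close>

definition standard_ordering ::
    "'v set \<Rightarrow> ('v \<Rightarrow> 'v \<Rightarrow> bool) \<Rightarrow> nat \<Rightarrow> real \<Rightarrow> real \<Rightarrow> real \<Rightarrow> (nat \<Rightarrow> 'v cmat) \<Rightarrow> bool" where
  "standard_ordering V adj d q \<alpha> \<beta> E \<longleftrightarrow>
     classical_parameters V adj d q \<alpha> \<beta> \<and> Q_polynomial V adj E \<and>
     (\<exists>\<theta> :: nat \<Rightarrow> complex. 
        (\<forall>x\<in>V. \<forall>y\<in>V. of_nat (card V) * E 1 x y = (\<Sum>i\<le>d. \<theta> i * dist_mat V adj i x y)) \<and>
        (\<exists>\<xi> \<zeta>. \<xi> \<noteq> 0 \<and> (\<forall>i\<le>d. \<theta> i = \<xi> * of_real (qint q (d - i)) + \<zeta>)))"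

subsection \<open>Descendents\<close>

definition char_form :: "'v set \<Rightarrow> 'v set \<Rightarrow> 'v cmat \<Rightarrow> complex" where
  "char_form V Y M = (\<Sum>x\<in>V. \<Sum>y\<in>V. indicator Y x * M x y * indicator Y y)"

definition graph_width :: "'v set \<Rightarrow> ('v \<Rightarrow> 'v \<Rightarrow> bool) \<Rightarrow> 'v set \<Rightarrow> nat" where
  "graph_width V adj Y =
     Max {i. i \<le> graph_diameter V adj \<and> char_form V Y (dist_mat V adj i) \<noteq> 0}"

definition dual_width ::
    "'v set \<Rightarrow> ('v \<Rightarrow> 'v \<Rightarrow> bool) \<Rightarrow> (nat \<Rightarrow> 'v cmat) \<Rightarrow> 'v set \<Rightarrow> nat" where
  "dual_width V adj E Y = Max {i. i \<le> graph_diameter V adj \<and> char_form V Y (E i) \<noteq> 0}"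

definition descendent ::
    "'v set \<Rightarrow> ('v \<Rightarrow> 'v \<Rightarrow> bool) \<Rightarrow> (nat \<Rightarrow> 'v cmat) \<Rightarrow> 'v set \<Rightarrow> bool" where
  "descendent V adj E Y \<longleftrightarrow>
     Y \<noteq> {} \<and> Y \<subseteq> V \<and> graph_width V adj Y + dual_width V adj E Y = graph_diameter V adj"

definition nontrivial_descendent ::
    "'v set \<Rightarrow> ('v \<Rightarrow> 'v \<Rightarrow> bool) \<Rightarrow> (nat \<Rightarrow> 'v cmat) \<Rightarrow> 'v set \<Rightarrow> bool" where
  "nontrivial_descendent V adj E Y \<longleftrightarrow>
     descendent V adj E Y \<and> graph_width V adj Y \<noteq> 0 \<and>
     graph_width V adj Y \<noteq> graph_diameter V adj"

subsection \<open>Symplectic dual polar graphs and Hemmeter graphs\<close>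

definition symplectic_form :: "('a::field ^ 'n \<Rightarrow> 'a ^ 'n \<Rightarrow> 'a) \<Rightarrow> bool" where
  "symplectic_form B \<longleftrightarrow>
     (\<forall>u. Vector_Spaces.linear (*s) (*) (\<lambda>v. B u v)) \<and>
     (\<forall>v. Vector_Spaces.linear (*s) (*) (\<lambda>u. B u v)) \<and>
     (\<forall>v. B v v = 0) \<and>
     (\<forall>u. (\<forall>v. B u v = 0) \<longrightarrow> u = 0)"

definition isotropic :: "('a::field ^ 'n \<Rightarrow> 'a ^ 'n \<Rightarrow> 'a) \<Rightarrow> ('a ^ 'n) set \<Rightarrow> bool" where
  "isotropic B u \<longleftrightarrow> vec.subspace u \<and> (\<forall>x\<in>u. \<forall>y\<in>u. B x y = 0)"

definition dual_polar_verts :: "('a::field ^ 'n \<Rightarrow> 'a ^ 'n \<Rightarrow> 'a) \<Rightarrow> ('a ^ 'n) set set" where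
  "dual_polar_verts B = {x. isotropic B x \<and> (\<forall>y. isotropic B y \<and> x \<subseteq> y \<longrightarrow> y = x)}"

text \<open>
  For \<open>[C\<^bsub>d-1\<^esub>(q)]\<close>, i.e. ambient dimension \<open>2 * d - 2\<close>, the vertices have dimension \<open>d - 1\<close>.
\<close>

definition dual_polar_adj ::
    "nat \<Rightarrow> ('a::field ^ 'n \<Rightarrow> 'a ^ 'n \<Rightarrow> 'a) \<Rightarrow> ('a ^ 'n) set \<Rightarrow> ('a ^ 'n) set \<Rightarrow> bool" where
  "dual_polar_adj d B x y \<longleftrightarrow>
     x \<in> dual_polar_verts B \<and> y \<in> dual_polar_verts B \<and> vec.dim (x \<inter> y) = d - 2"

text \<open>The boolean component of a vertex is the sign: \<open>(x, True)\<close> is \<open>x\<^sup>+\<close>, \<open>(x, False)\<close> is \<open>x\<^sup>-\<close>.\<close>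

definition hem_verts :: "('a::field ^ 'n \<Rightarrow> 'a ^ 'n \<Rightarrow> 'a) \<Rightarrow> (('a ^ 'n) set \<times> bool) set" where
  "hem_verts B = dual_polar_verts B \<times> UNIV"

definition hem_adj ::
    "nat \<Rightarrow> ('a::field ^ 'n \<Rightarrow> 'a ^ 'n \<Rightarrow> 'a) \<Rightarrow>
     ('a ^ 'n) set \<times> bool \<Rightarrow> ('a ^ 'n) set \<times> bool \<Rightarrow> bool" where
  "hem_adj d B p r \<longleftrightarrow>
     p \<in> hem_verts B \<and> r \<in> hem_verts B \<and> snd p \<noteq> snd r \<and>
     (fst p = fst r \<or> dual_polar_adj d B (fst p) (fst r))"

end

theory Submission
  imports Defs "HOL-Computational_Algebra.Polynomial"
begin

text \<open>
  Write \<open>\<chi>\<close> for the characteristic vector of a descendent \<open>Y\<close>. Since \<open>E\<^sub>i \<chi> = 0\<close> for \<open>i > w*\<close>, the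
  numbers \<open>a\<^sub>i = |Y \<inter> \<Gamma>\<^sub>i(x)|\<close> for \<open>x \<in> Y\<close> have the form \<open>k\<^sub>i p(\<theta>\<^sub>i*)\<close> with \<open>deg p \<le> w* = d - w\<close>;
  as \<open>p\<close> vanishes at \<open>\<theta>\<^sub>i*\<close> for \<open>i > w\<close> and \<open>a\<^sub>0 = 1\<close>, it is determined, and the \<open>a\<^sub>i\<close> are the sphere
  sizes of a graph with classical parameters \<open>(w, q, 0, 1)\<close>. Counting edges between spheres then
  shows that \<open>Y\<close> is geodetically convex.

  Let \<open>w \<ge> 2\<close> and suppose \<open>x\<^sup>+ \<in> Y\<close>, \<open>x\<^sup>- \<notin> Y\<close>. Inside a quad of \<open>\<Sigma>\<close> convexity makes \<open>Y\<close> grow until it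
  contains two adjacent neighbours of \<open>x\<close>, because the quad is an antiregular generalized quadrangle
  for odd \<open>q\<close>; this contradicts convexity together with \<open>x\<^sup>- \<notin> Y\<close>. So \<open>Y\<close> is closed under changing
  signs and comes from a convex set in \<open>\<Sigma>\<close> of diameter \<open>w - 1\<close>. For an antipodal pair \<open>x, y\<close> in it,
  \<open>u = x \<inter> y\<close> has dimension \<open>d - w\<close>, and \<open>u\<close> propagates to all of \<open>Y\<close> along geodesics.
\<close>

section \<open>Distance-regular graphs\<close>

locale drg =
  fixes V :: "'v set" and adj :: "'v \<Rightarrow> 'v \<Rightarrow> bool" and b c :: "nat \<Rightarrow> nat"
  assumes simple: "simple_graph V adj"
    and conn: "connected_graph V adj"
    and inums: "intersection_numbers V adj b c"
begin

abbreviation "ds \<equiv> graph_dist adj"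
abbreviation "D \<equiv> graph_diameter V adj"

lemma finV [simp]: "finite V" and adj_sym: "adj x y \<Longrightarrow> adj y x"
  and adj_in: "adj x y \<Longrightarrow> x \<in> V" "adj x y \<Longrightarrow> y \<in> V" and adj_irrefl: "adj x y \<Longrightarrow> x \<noteq> y"
  using simple by (auto simp: simple_graph_def)

lemma dist_path: assumes "x \<in> V" "y \<in> V" shows "(adj ^^ ds x y) x y"
proof -
  have "adj\<^sup>*\<^sup>* x y" using conn assms by (auto simp: connected_graph_def)
  then obtain n where "(adj ^^ n) x y" by (auto dest: rtranclp_imp_relpowp)
  then show ?thesis unfolding graph_dist_def by (rule LeastI)
qed

lemma dist_le: "(adj ^^ n) x y \<Longrightarrow> ds x y \<le> n"
  unfolding graph_dist_def by (rule Least_le)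

lemma relpow_sym: "(adj ^^ n) x y \<Longrightarrow> (adj ^^ n) y x"
proof (induction n arbitrary: y)
  case (Suc n)
  then obtain z where "(adj ^^ n) x z" "adj z y" by auto
  then show ?case using Suc.IH adj_sym by (blast intro: relpowp_Suc_I2)
qed simp

lemma dist_sym: "ds x y = ds y x"
  unfolding graph_dist_def by (rule arg_cong[where f = Least]) (use relpow_sym in blast)

lemma dist_refl [simp]: "ds x x = 0"
  using dist_le[of 0 x x] by simp

lemma dist_0: "x \<in> V \<Longrightarrow> y \<in> V \<Longrightarrow> ds x y = 0 \<longleftrightarrow> x = y"
  using dist_path[of x y] by auto

lemma dist_step: assumes "x \<in> V" "adj y z" shows "ds x z \<le> ds x y + 1"
proof -
  have "(adj ^^ Suc (ds x y)) x z"
    using dist_path[OF assms(1) adj_in(1)[OF assms(2)]] assms(2) by (rule relpowp_Suc_I)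
  then show ?thesis using dist_le by fastforce
qed

lemma dist_1: assumes "x \<in> V" "y \<in> V" shows "ds x y = 1 \<longleftrightarrow> adj x y"
proof
  assume "ds x y = 1"
  then show "adj x y" using dist_path[OF assms] by auto
next
  assume a: "adj x y"
  then have "ds x y \<le> 1" using dist_step[OF adj_in(1)[OF a] a] by simp
  moreover have "ds x y \<noteq> 0" using dist_0[OF assms] adj_irrefl[OF a] by simp
  ultimately show "ds x y = 1" by simp
qed

lemma dist_pred:
  assumes "x \<in> V" "y \<in> V" "ds x y = Suc i"
  obtains z where "adj y z" "ds x z = i"
proof -
  have "(adj ^^ Suc i) x y" using dist_path[OF assms(1,2)] assms(3) by simp
  then obtain z where z: "(adj ^^ i) x z" "adj z y" by auto
  have "ds x z \<le> i" using z dist_le by blast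
  moreover have "ds x y \<le> ds x z + 1" using dist_step[OF assms(1) z(2)] .
  ultimately have "ds x z = i" using assms by simp
  then show ?thesis using that z adj_sym by blast
qed

lemma dist_le_D: assumes "x \<in> V" "y \<in> V" shows "ds x y \<le> D"
proof -
  have "{ds x y | x y. x \<in> V \<and> y \<in> V} = (\<lambda>(x, y). ds x y) ` (V \<times> V)" by auto
  then have "finite {ds x y | x y. x \<in> V \<and> y \<in> V}" by simp
  then show ?thesis unfolding graph_diameter_def using assms by (intro Max_ge) auto
qed

lemma card_up: "x \<in> V \<Longrightarrow> y \<in> V \<Longrightarrow> card {z\<in>V. adj y z \<and> ds x z = ds x y + 1} = b (ds x y)"
  and card_down: "x \<in> V \<Longrightarrow> y \<in> V \<Longrightarrow> card {z\<in>V. adj y z \<and> ds x z + 1 = ds x y} = c (ds x y)"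
  using inums by (auto simp: intersection_numbers_def)

lemma card_nbrs: assumes "y \<in> V" shows "card {z\<in>V. adj y z} = b 0"
proof -
  have "{z\<in>V. adj y z} = {z\<in>V. adj y z \<and> ds y z = ds y y + 1}"
    using dist_1 assms by auto
  then show ?thesis using card_up[OF assms assms] by simp
qed

lemma c_pos: assumes "x \<in> V" "y \<in> V" "ds x y = Suc i" shows "c (Suc i) > 0"
proof -
  obtain z where z: "adj y z" "ds x z = i" using dist_pred[OF assms] .
  then have "z \<in> {z\<in>V. adj y z \<and> ds x z + 1 = ds x y}" using assms adj_in by auto
  then have "card {z\<in>V. adj y z \<and> ds x z + 1 = ds x y} > 0" by (intro card_gt_0_iff[THEN iffD2]) auto
  then show ?thesis using card_down[OF assms(1,2)] assms(3) by simp
qed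

text \<open>A way to compute distances without handling paths: \<open>f\<close> grows by at most one
  per edge, so it is a lower bound, and it can always be lowered along some edge, so it is attained.
  It serves to verify the explicit distance formula of the Hemmeter graph.\<close>

lemma dist_eqI:
  assumes zero: "\<And>x y. x \<in> V \<Longrightarrow> y \<in> V \<Longrightarrow> f x y = 0 \<longleftrightarrow> x = y"
    and step: "\<And>x y z. x \<in> V \<Longrightarrow> adj y z \<Longrightarrow> f x z \<le> f x y + 1"
    and closer: "\<And>x y. x \<in> V \<Longrightarrow> y \<in> V \<Longrightarrow> f x y > 0 \<Longrightarrow> \<exists>z. adj y z \<and> f x z + 1 = f x y"
    and x: "x \<in> V" and y: "y \<in> V"
  shows "ds x y = f x y"
proof (rule antisym)
  show "ds x y \<le> f x y" using y
  proof (induction "f x y" arbitrary: y)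
    case 0
    then show ?case using zero[OF x] by simp
  next
    case (Suc k)
    then obtain z where z: "adj y z" "f x z + 1 = f x y" using closer[OF x Suc.prems] by auto
    then have "f x z = k" using Suc.hyps(2) by simp
    then have "ds x z \<le> k" using Suc.hyps(1)[of z] adj_in(2)[OF z(1)] by simp
    then show ?case using dist_step[OF x adj_sym[OF z(1)]] Suc.hyps(2) by linarith
  qed
  show "f x y \<le> ds x y" using y
  proof (induction "ds x y" arbitrary: y)
    case 0
    then show ?case using zero[OF x] dist_0[OF x] by simp
  next
    case (Suc k)
    obtain z where z: "adj y z" "ds x z = k" using dist_pred[OF x Suc.prems Suc.hyps(2)[symmetric]] .
    then have "f x z \<le> k" using Suc.hyps(1)[of z] adj_in(2) by simp
    then show ?case using step[OF x adj_sym[OF z(1)]] Suc by linarith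
  qed
qed

subsection \<open>The Bose-Mesner algebra\<close>

text \<open>Elements of the Bose-Mesner algebra are handled through their entry function on
  distances. Different \<open>f\<close> can give the same matrix, since only distances that occur
  matter.\<close>

definition bmat :: "(nat \<Rightarrow> complex) \<Rightarrow> 'v cmat" where
  "bmat f = (\<lambda>x y. if x \<in> V \<and> y \<in> V then f (ds x y) else 0)"

lemma bmat_in [simp]: "x \<in> V \<Longrightarrow> y \<in> V \<Longrightarrow> bmat f x y = f (ds x y)"
  by (simp add: bmat_def)

lemma bmat_cong: "(\<And>x y. x \<in> V \<Longrightarrow> y \<in> V \<Longrightarrow> f (ds x y) = g (ds x y)) \<Longrightarrow> bmat f = bmat g"
  by (auto simp: bmat_def fun_eq_iff)

lemma sum_dist_mat:
  "(\<lambda>x y. \<Sum>i\<le>D. f i * dist_mat V adj i x y) = bmat f"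
proof (intro ext)
  fix x y
  show "(\<Sum>i\<le>D. f i * dist_mat V adj i x y) = bmat f x y"
  proof (cases "x \<in> V \<and> y \<in> V")
    case True
    then have "(\<Sum>i\<le>D. f i * dist_mat V adj i x y) = (\<Sum>i\<le>D. if i = ds x y then f i else 0)"
      by (intro sum.cong) (auto simp: dist_mat_def)
    then show ?thesis using True dist_le_D[of x y] by (simp add: bmat_def)
  qed (auto simp: bmat_def dist_mat_def)
qed

lemma bose_mesner_iff: "M \<in> bose_mesner V adj \<longleftrightarrow> (\<exists>f. M = bmat f)"
  unfolding bose_mesner_def sum_dist_mat by simp

abbreviation mm (infixl "**\<^sub>V" 70) where "mm \<equiv> mat_mult V"

lemma mm_assoc: "(L **\<^sub>V M) **\<^sub>V N = L **\<^sub>V (M **\<^sub>V N)"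
proof (intro ext)
  fix x y
  have "((L **\<^sub>V M) **\<^sub>V N) x y = (\<Sum>z\<in>V. \<Sum>w\<in>V. L x w * M w z * N z y)"
    by (simp add: mat_mult_def sum_distrib_right)
  also have "\<dots> = (\<Sum>w\<in>V. \<Sum>z\<in>V. L x w * M w z * N z y)" by (rule sum.swap)
  also have "\<dots> = (L **\<^sub>V (M **\<^sub>V N)) x y"
    by (simp add: mat_mult_def sum_distrib_left mult.assoc)
  finally show "((L **\<^sub>V M) **\<^sub>V N) x y = (L **\<^sub>V (M **\<^sub>V N)) x y" .
qed

lemma mm_diff_left: "(\<lambda>x y. L x y - M x y) **\<^sub>V N = (\<lambda>x y. (L **\<^sub>V N) x y - (M **\<^sub>V N) x y)"
  and mm_diff_right: "N **\<^sub>V (\<lambda>x y. L x y - M x y) = (\<lambda>x y. (N **\<^sub>V L) x y - (N **\<^sub>V M) x y)"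
  by (auto simp: mat_mult_def fun_eq_iff algebra_simps sum_subtractf)

text \<open>The entry function of \<open>bmat f\<close> times the adjacency matrix: all
  \<open>b 0\<close> neighbours are first counted with \<open>f l\<close>, then those at distance
  \<open>l + 1\<close> and \<open>l - 1\<close> are corrected. At \<open>l = 0\<close> the truncated
  \<open>l - 1\<close> makes the last term vanish.\<close>

definition adj_shift :: "(nat \<Rightarrow> complex) \<Rightarrow> nat \<Rightarrow> complex" where
  "adj_shift f l = f l * of_nat (b 0) + (f (l + 1) - f l) * of_nat (b l)
     + (f (l - 1) - f l) * of_nat (c l)"

lemma mm_adj: "bmat f **\<^sub>V bmat (\<lambda>i. if i = 1 then 1 else 0) = bmat (adj_shift f)"
proof (intro ext)
  fix x y
  show "(bmat f **\<^sub>V bmat (\<lambda>i. if i = 1 then 1 else 0)) x y = bmat (adj_shift f) x y"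
  proof (cases "x \<in> V \<and> y \<in> V")
    case True
    define l where "l = ds x y"
    let ?N = "{z\<in>V. adj y z}"
    have "(bmat f **\<^sub>V bmat (\<lambda>i. if i = 1 then 1 else 0)) x y = (\<Sum>z\<in>V. if adj y z then f (ds x z) else 0)"
      unfolding mat_mult_def using True dist_1 adj_sym by (intro sum.cong) auto
    also have "\<dots> = (\<Sum>z\<in>?N. f (ds x z))" by (intro sum.inter_filter[symmetric]) simp
    also have "\<dots> = (\<Sum>z\<in>?N. f l + (f (l + 1) - f l) * (if ds x z = l + 1 then 1 else 0)
        + (f (l - 1) - f l) * (if ds x z + 1 = l then 1 else 0))"
    proof (intro sum.cong refl)
      fix z assume "z \<in> ?N"
      then have "ds x z \<le> l + 1" "l \<le> ds x z + 1"
        using dist_step[of x y z] dist_step[of x z y] True adj_sym l_def by auto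
      then consider "ds x z = l" | "ds x z = l + 1" | "ds x z + 1 = l" by linarith
      then show "f (ds x z) = f l + (f (l + 1) - f l) * (if ds x z = l + 1 then 1 else 0)
        + (f (l - 1) - f l) * (if ds x z + 1 = l then 1 else 0)"
        by cases auto
    qed
    also have "\<dots> = f l * of_nat (card ?N)
        + (f (l + 1) - f l) * (\<Sum>z\<in>?N. if ds x z = l + 1 then 1 else 0)
        + (f (l - 1) - f l) * (\<Sum>z\<in>?N. if ds x z + 1 = l then 1 else 0)"
      by (simp add: sum.distrib sum_distrib_left)
    also have "(\<Sum>z\<in>?N. if ds x z = l + 1 then 1 else 0) = (of_nat (b l) :: complex)"
    proof -
      have "(\<Sum>z\<in>?N. if ds x z = l + 1 then 1 else 0) = (of_nat (card {z\<in>?N. ds x z = l + 1}) :: complex)"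
        by (subst sum.inter_filter[symmetric]) simp_all
      also have "{z\<in>?N. ds x z = l + 1} = {z\<in>V. adj y z \<and> ds x z = l + 1}" by auto
      finally show ?thesis using card_up[of x y] True l_def by simp
    qed
    also have "(\<Sum>z\<in>?N. if ds x z + 1 = l then 1 else 0) = (of_nat (c l) :: complex)"
    proof -
      have "(\<Sum>z\<in>?N. if ds x z + 1 = l then 1 else 0) = (of_nat (card {z\<in>?N. ds x z + 1 = l}) :: complex)"
        by (subst sum.inter_filter[symmetric]) simp_all
      also have "{z\<in>?N. ds x z + 1 = l} = {z\<in>V. adj y z \<and> ds x z + 1 = l}" by auto
      finally show ?thesis using card_down[of x y] True l_def by simp
    qed
    finally show ?thesis using card_nbrs True by (simp add: adj_shift_def l_def)
  qed (auto simp: mat_mult_def bmat_def)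
qed

text \<open>Closure under products is proved by varying the right factor: the \<open>g\<close> with
  this property form a linear space that contains the identity matrix and is stable under
  multiplication by the adjacency matrix.\<close>

definition bm_right :: "(nat \<Rightarrow> complex) \<Rightarrow> bool" where
  "bm_right g \<longleftrightarrow> (\<forall>f. \<exists>h. bmat f **\<^sub>V bmat g = bmat h)"

lemma bm_right_add:
  assumes "bm_right g" "bm_right h" shows "bm_right (\<lambda>i. s * g i + t * h i)"
  unfolding bm_right_def
proof
  fix f
  obtain u v where "bmat f **\<^sub>V bmat g = bmat u" "bmat f **\<^sub>V bmat h = bmat v"
    using assms unfolding bm_right_def by blast
  then have "(\<Sum>z\<in>V. bmat f x z * bmat g z y) = bmat u x y"
    "(\<Sum>z\<in>V. bmat f x z * bmat h z y) = bmat v x y" for x y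
    by (auto simp: mat_mult_def fun_eq_iff)
  moreover have "bmat (\<lambda>i. s * g i + t * h i) z y = s * bmat g z y + t * bmat h z y" for z y
    by (simp add: bmat_def)
  moreover have "(\<Sum>z\<in>V. bmat f x z * (s * bmat g z y + t * bmat h z y))
      = s * (\<Sum>z\<in>V. bmat f x z * bmat g z y) + t * (\<Sum>z\<in>V. bmat f x z * bmat h z y)" for x y
    by (simp add: sum.distrib sum_distrib_left algebra_simps)
  ultimately have "bmat f **\<^sub>V bmat (\<lambda>i. s * g i + t * h i) = bmat (\<lambda>i. s * u i + t * v i)"
    unfolding mat_mult_def by (auto simp: bmat_def fun_eq_iff)
  then show "\<exists>k. bmat f **\<^sub>V bmat (\<lambda>i. s * g i + t * h i) = bmat k" by blast
qed

lemma bm_right_delta_0: "bm_right (\<lambda>i. if i = 0 then 1 else 0)"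
proof -
  have "bmat f **\<^sub>V bmat (\<lambda>i. if i = 0 then 1 else 0) = bmat f" for f
  proof (intro ext)
    fix x y
    show "(bmat f **\<^sub>V bmat (\<lambda>i. if i = 0 then 1 else 0)) x y = bmat f x y"
    proof (cases "x \<in> V \<and> y \<in> V")
      case True
      then have "(bmat f **\<^sub>V bmat (\<lambda>i. if i = 0 then 1 else 0)) x y = (\<Sum>z\<in>V. if z = y then f (ds x z) else 0)"
        unfolding mat_mult_def by (intro sum.cong) (auto simp: dist_0)
      then show ?thesis using True by simp
    qed (auto simp: mat_mult_def bmat_def)
  qed
  then show ?thesis unfolding bm_right_def by blast
qed

lemma bm_right_shift: assumes "bm_right g" shows "bm_right (adj_shift g)"
  unfolding bm_right_def
proof
  fix f
  obtain h where h: "bmat f **\<^sub>V bmat g = bmat h" using assms unfolding bm_right_def by blast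
  have "bmat f **\<^sub>V bmat (adj_shift g) = bmat (adj_shift h)"
    unfolding mm_adj[symmetric] mm_assoc[symmetric] h ..
  then show "\<exists>h. bmat f **\<^sub>V bmat (adj_shift g) = bmat h" by blast
qed

lemma bm_right_cong: "bm_right g \<Longrightarrow> bmat h = bmat g \<Longrightarrow> bm_right h"
  by (simp add: bm_right_def)

text \<open>Each distance matrix is a polynomial in the adjacency matrix, by the three-term
  recurrence. A distance that does not occur gives the zero matrix and is split off, so that the
  divisor \<open>c j\<close> is positive in the main case.\<close>

lemma bm_right_delta: "bm_right (\<lambda>i. if i = j then 1 else 0)"
proof (induction j rule: less_induct)
  case (less j)
  let ?\<delta> = "\<lambda>j i. if i = j then 1 else (0 :: complex)"
  show ?case
  proof (cases "j = 0 \<or> (\<nexists>x y. x \<in> V \<and> y \<in> V \<and> ds x y = j)")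
    case True
    then show ?thesis
    proof
      assume "\<nexists>x y. x \<in> V \<and> y \<in> V \<and> ds x y = j"
      then have "bmat (?\<delta> j) = bmat (\<lambda>i. 0 * ?\<delta> 0 i + 0 * ?\<delta> 0 i)" by (intro bmat_cong) auto
      then show ?thesis using bm_right_cong bm_right_add bm_right_delta_0 by blast
    qed (use bm_right_delta_0 in simp)
  next
    case False
    then obtain i where i: "j = Suc i" by (cases j) auto
    have c: "c (Suc i) > 0" using False i c_pos by blast
    text \<open>Solve \<open>A\<^sub>i A = b\<^bsub>i-1\<^esub> A\<^bsub>i-1\<^esub> + a\<^sub>i A\<^sub>i + c\<^bsub>i+1\<^esub> A\<^bsub>i+1\<^esub>\<close> for the last matrix.\<close>
    define s where "s = (of_nat (b 0) :: complex) - of_nat (b i) - of_nat (c i)"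
    \<comment> \<open>There is no matrix preceding \<open>A\<^sub>0\<close>, so this term is set to
      zero at \<open>i = 0\<close> instead of using the truncated \<open>i - 1\<close>.\<close>
    let ?P = "\<lambda>l. if i = 0 then 0 * ?\<delta> 0 l else of_nat (b (i - 1)) * ?\<delta> (i - 1) l"
    have P: "bm_right (\<lambda>l. s * ?\<delta> i l + 1 * ?P l)"
    proof (cases "i = 0")
      case True
      then show ?thesis using bm_right_add[OF bm_right_delta_0 bm_right_delta_0, of s 0] by simp
    next
      case False
      then show ?thesis using bm_right_add[OF less.IH less.IH, of i "i - 1" s "of_nat (b (i - 1))"] i by simp
    qed
    have "bm_right (\<lambda>l. (1 / of_nat (c (Suc i))) * adj_shift (?\<delta> i) l
        + (- 1 / of_nat (c (Suc i))) * (s * ?\<delta> i l + 1 * ?P l))" (is "bm_right ?g")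
      by (intro bm_right_add bm_right_shift less.IH P) (simp add: i)
    moreover have "bmat (?\<delta> j) = bmat ?g"
    proof (rule bmat_cong)
      fix x y assume xy: "x \<in> V" "y \<in> V"
      define l where "l = ds x y"
      consider "l = Suc i" | "l = i" | "Suc l = i" | "l \<noteq> Suc i" "l \<noteq> i" "Suc l \<noteq> i" by blast
      then have "?\<delta> j l = ?g l"
      proof cases
        case 1
        then show ?thesis using c i by (auto simp: adj_shift_def)
      next
        case 2
        have "l = 0 \<Longrightarrow> c 0 = 0" using card_down[of x x] xy by auto
        then show ?thesis using 2 i by (cases "i = 0") (auto simp: adj_shift_def s_def algebra_simps)
      next
        case 3
        then show ?thesis using i by (auto simp: adj_shift_def)
      next
        case 4
        moreover have "l - 1 = i \<Longrightarrow> l = 0 \<and> i = 0" using 4 by auto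
        ultimately show ?thesis using i by (auto simp: adj_shift_def)
      qed
      then show "?\<delta> j (ds x y) = ?g (ds x y)" by (simp add: l_def)
    qed
    ultimately show ?thesis using bm_right_cong by blast
  qed
qed

lemma bm_right: "bm_right g"
proof -
  have "bm_right (\<lambda>i. if i < n then g i else 0)" for n
  proof (induction n)
    case 0
    show ?case using bm_right_add[OF bm_right_delta_0 bm_right_delta_0, of 0 0] by simp
  next
    case (Suc n)
    have "(\<lambda>i. if i < Suc n then g i else 0)
        = (\<lambda>i. 1 * (if i < n then g i else 0) + g n * (if i = n then 1 else 0))"
      by (auto simp: fun_eq_iff less_Suc_eq)
    then show ?case using bm_right_add[OF Suc bm_right_delta[of n], of 1 "g n"] by simp
  qed
  note this[of "Suc D"]
  moreover have "bmat g = bmat (\<lambda>i. if i < Suc D then g i else 0)"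
    using dist_le_D by (intro bmat_cong) (simp add: less_Suc_eq_le)
  ultimately show ?thesis using bm_right_cong by blast
qed

lemma bmat_mm: obtains h where "bmat f **\<^sub>V bmat g = bmat h"
  using bm_right unfolding bm_right_def by blast

lemma bmat_sym: "bmat f x y = bmat f y x"
  by (auto simp: bmat_def dist_sym)

text \<open>The product lies in the algebra again and is therefore symmetric, while transposing a
  product of symmetric matrices reverses the factors.\<close>

lemma bmat_commute: "bmat f **\<^sub>V bmat g = bmat g **\<^sub>V bmat f"
proof (intro ext)
  fix x y
  obtain h where h: "bmat f **\<^sub>V bmat g = bmat h" by (rule bmat_mm)
  have "(bmat f **\<^sub>V bmat g) x y = (bmat f **\<^sub>V bmat g) y x" unfolding h by (rule bmat_sym)
  also have "\<dots> = (bmat g **\<^sub>V bmat f) x y"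
    unfolding mat_mult_def using bmat_sym by (intro sum.cong) (auto simp: mult.commute)
  finally show "(bmat f **\<^sub>V bmat g) x y = (bmat g **\<^sub>V bmat f) x y" .
qed

text \<open>Otherwise \<open>M\<close> would be the sum of the two nonzero orthogonal idempotents
  \<open>M F\<close> and \<open>M - M F\<close> of the algebra, against primitivity.\<close>

lemma primitive_absorbs:
  assumes "M \<in> primitive_idempotents V adj" "F \<in> bose_mesner V adj" "F **\<^sub>V F = F"
  shows "M **\<^sub>V F = (\<lambda>x y. 0) \<or> M **\<^sub>V F = M"
proof (rule ccontr)
  assume neg: "\<not> ?thesis"
  obtain e f where ef: "M = bmat e" "F = bmat f"
    using assms bose_mesner_iff by (auto simp: primitive_idempotents_def)
  have MM: "M **\<^sub>V M = M" using assms by (auto simp: primitive_idempotents_def nonzero_idempotent_def)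
  have comm: "F **\<^sub>V M = M **\<^sub>V F" using ef bmat_commute by simp
  define P where "P = M **\<^sub>V F"
  define R where "R = (\<lambda>x y. M x y - P x y)"
  obtain h where h: "P = bmat h" using ef P_def bmat_mm by metis
  have PM: "P **\<^sub>V M = P" and MP: "M **\<^sub>V P = P" and PP: "P **\<^sub>V P = P"
  proof -
    show MP: "M **\<^sub>V P = P" by (simp add: P_def mm_assoc[symmetric] MM)
    show PM: "P **\<^sub>V M = P" by (simp add: P_def mm_assoc comm) (simp add: mm_assoc[symmetric] MM)
    have "P **\<^sub>V P = (P **\<^sub>V M) **\<^sub>V F" by (simp add: P_def mm_assoc)
    also have "\<dots> = M **\<^sub>V (F **\<^sub>V F)" unfolding PM by (simp add: P_def mm_assoc)
    finally show "P **\<^sub>V P = P" by (simp add: P_def assms(3))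
  qed
  have R: "R = bmat (\<lambda>i. e i - h i)" by (auto simp: R_def ef h bmat_def fun_eq_iff)
  have "nonzero_idempotent V P" using neg PP by (simp add: P_def nonzero_idempotent_def)
  moreover have "nonzero_idempotent V R"
  proof -
    have "R \<noteq> (\<lambda>x y. 0)"
    proof
      assume "R = (\<lambda>x y. 0)"
      then have "M = P" by (auto simp: R_def fun_eq_iff)
      then show False using neg P_def by simp
    qed
    moreover have "R **\<^sub>V R = R"
      unfolding R_def mm_diff_left mm_diff_right by (simp add: MM PM MP PP)
    ultimately show ?thesis by (simp add: nonzero_idempotent_def)
  qed
  moreover have "P **\<^sub>V R = (\<lambda>x y. 0)" "R **\<^sub>V P = (\<lambda>x y. 0)"
    unfolding R_def mm_diff_left mm_diff_right by (simp_all add: PM MP PP)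
  moreover have "M = (\<lambda>x y. P x y + R x y)" by (auto simp: R_def)
  moreover have "P \<in> bose_mesner V adj" "R \<in> bose_mesner V adj"
    using h R bose_mesner_iff by blast+
  ultimately show False using assms(1) unfolding primitive_idempotents_def by blast
qed

text \<open>Each of \<open>M\<close>, \<open>N\<close> absorbs or annihilates the other. As they
  commute, a nonzero product would equal both of them.\<close>

lemma primitive_orthogonal:
  assumes "M \<in> primitive_idempotents V adj" "N \<in> primitive_idempotents V adj" "M \<noteq> N"
  shows "M **\<^sub>V N = (\<lambda>x y. 0)"
proof -
  obtain e f where ef: "M = bmat e" "N = bmat f"
    using assms bose_mesner_iff by (auto simp: primitive_idempotents_def)
  have "M **\<^sub>V N = (\<lambda>x y. 0) \<or> M **\<^sub>V N = M" "N **\<^sub>V M = (\<lambda>x y. 0) \<or> N **\<^sub>V M = N"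
    using assms primitive_absorbs by (auto simp: primitive_idempotents_def nonzero_idempotent_def)
  then show ?thesis using assms(3) bmat_commute[of e f] ef by auto
qed

lemma mm_bmat_diag:
  assumes "x \<in> V" shows "(bmat e **\<^sub>V bmat f) x x = (\<Sum>y\<in>V. e (ds x y) * f (ds x y))"
  unfolding mat_mult_def using assms dist_sym by (intro sum.cong) auto

lemma bmat_cnj: "bmat (\<lambda>i. cnj (e i)) x y = cnj (bmat e x y)"
  by (simp add: bmat_def)

text \<open>The conjugate of a primitive idempotent is an idempotent of the algebra. Their product
  is not zero, since its diagonal entries are sums of squared moduli, so absorption gives
  \<open>M = M C\<close>; by commutativity \<open>M C\<close> is its own conjugate.\<close>

lemma primitive_real:
  assumes "bmat e \<in> primitive_idempotents V adj" "x \<in> V" "y \<in> V"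
  shows "cnj (e (ds x y)) = e (ds x y)"
proof -
  let ?M = "bmat e" and ?C = "bmat (\<lambda>i. cnj (e i))"
  have MM: "?M **\<^sub>V ?M = ?M" and nz: "?M \<noteq> (\<lambda>x y. 0)"
    using assms by (auto simp: primitive_idempotents_def nonzero_idempotent_def)
  have CC: "?C **\<^sub>V ?C = ?C"
  proof (intro ext)
    fix x y
    have "(?C **\<^sub>V ?C) x y = cnj ((?M **\<^sub>V ?M) x y)" by (simp add: mat_mult_def bmat_cnj)
    then show "(?C **\<^sub>V ?C) x y = ?C x y" by (simp only: MM bmat_cnj)
  qed
  have "?M **\<^sub>V ?C = (\<lambda>x y. 0) \<or> ?M **\<^sub>V ?C = ?M"
    using primitive_absorbs[OF assms(1) _ CC] bose_mesner_iff by blast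
  then show ?thesis
  proof
    assume z: "?M **\<^sub>V ?C = (\<lambda>x y. 0)"
    have "e (ds u v) = 0" if uv: "u \<in> V" "v \<in> V" for u v
    proof -
      have "(\<Sum>y\<in>V. e (ds u y) * cnj (e (ds u y))) = (?M **\<^sub>V ?C) u u"
        by (rule mm_bmat_diag[OF uv(1), symmetric])
      then have "(\<Sum>y\<in>V. e (ds u y) * cnj (e (ds u y))) = 0" unfolding z .
      then have "of_real (\<Sum>y\<in>V. (cmod (e (ds u y)))\<^sup>2) = (0 :: complex)"
        by (simp only: complex_norm_square of_real_sum)
      then have "(\<Sum>y\<in>V. (cmod (e (ds u y)))\<^sup>2) = 0" by (simp only: of_real_eq_0_iff)
      then have "(cmod (e (ds u v)))\<^sup>2 = 0" using uv by (subst (asm) sum_nonneg_eq_0_iff) auto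
      then show ?thesis by simp
    qed
    then have "?M = (\<lambda>x y. 0)" by (auto simp: bmat_def fun_eq_iff)
    then show ?thesis using nz by simp
  next
    assume m: "?M **\<^sub>V ?C = ?M"
    have "?C x y = cnj (?M x y)" by (rule bmat_cnj)
    also have "\<dots> = cnj ((?M **\<^sub>V ?C) x y)" unfolding m ..
    also have "\<dots> = (?C **\<^sub>V ?M) x y" by (simp add: mat_mult_def bmat_cnj)
    also have "?C **\<^sub>V ?M = ?M" using bmat_commute[of "\<lambda>i. cnj (e i)" e] m by (rule trans)
    finally show ?thesis using assms by simp
  qed
qed

end

section \<open>Characteristic vectors and primitive idempotents\<close>

context drg
begin

lemma sum_by_dist:
  fixes h :: "nat \<Rightarrow> complex"
  assumes "x \<in> V" "S \<subseteq> V"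
  shows "(\<Sum>y\<in>S. h (ds x y)) = (\<Sum>l\<le>D. of_nat (card {y\<in>S. ds x y = l}) * h l)"
proof -
  have "finite S" using assms finite_subset finV by blast
  then have "(\<Sum>y\<in>S. h (ds x y)) = (\<Sum>l\<le>D. \<Sum>y\<in>{y\<in>S. ds x y = l}. h (ds x y))"
    using assms dist_le_D by (intro sum.group[symmetric]) auto
  also have "\<dots> = (\<Sum>l\<le>D. \<Sum>y\<in>{y\<in>S. ds x y = l}. h l)" by (intro sum.cong) auto
  finally show ?thesis by simp
qed

lemma char_form_eq:
  assumes "Y \<subseteq> V" shows "char_form V Y M = (\<Sum>x\<in>Y. \<Sum>y\<in>Y. M x y)"
proof -
  have [simp]: "finite Y" using assms finite_subset finV by blast
  have "(\<Sum>y\<in>V. g y * indicator Y y) = (\<Sum>y\<in>Y. g y)" for g :: "'v \<Rightarrow> complex"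
    by (intro sum.mono_neutral_cong_right) (use assms in auto)
  then have "char_form V Y M = (\<Sum>x\<in>V. \<Sum>y\<in>Y. indicator Y x * M x y)"
    unfolding char_form_def by simp
  also have "\<dots> = (\<Sum>x\<in>Y. \<Sum>y\<in>Y. M x y)"
    by (intro sum.mono_neutral_cong_right) (use assms in auto)
  finally show ?thesis .
qed

text \<open>A primitive idempotent is real, symmetric and idempotent, so its quadratic form at the
  characteristic vector of \<open>Y\<close> is the squared norm of the projected vector.\<close>

lemma char_form_zero_imp_orthogonal:
  assumes prim: "bmat e \<in> primitive_idempotents V adj"
    and Y: "Y \<subseteq> V" and zero: "char_form V Y (bmat e) = 0" and x: "x \<in> V"
  shows "(\<Sum>y\<in>Y. bmat e x y) = 0"
proof -
  have EE: "bmat e **\<^sub>V bmat e = bmat e"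
    using prim by (auto simp: primitive_idempotents_def nonzero_idempotent_def)
  have real: "cnj (bmat e u v) = bmat e u v" for u v
    using primitive_real[OF prim] by (simp add: bmat_def)
  let ?u = "\<lambda>x. \<Sum>y\<in>Y. bmat e x y"
  have "(\<Sum>x\<in>V. ?u x * cnj (?u x)) = (\<Sum>x\<in>V. \<Sum>y\<in>Y. \<Sum>y'\<in>Y. bmat e y x * bmat e x y')"
    by (simp add: real sum_product bmat_sym)
  also have "\<dots> = (\<Sum>y\<in>Y. \<Sum>x\<in>V. \<Sum>y'\<in>Y. bmat e y x * bmat e x y')" by (rule sum.swap)
  also have "\<dots> = (\<Sum>y\<in>Y. \<Sum>y'\<in>Y. \<Sum>x\<in>V. bmat e y x * bmat e x y')"
    by (intro sum.cong refl sum.swap)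
  also have "\<dots> = (\<Sum>y\<in>Y. \<Sum>y'\<in>Y. (bmat e **\<^sub>V bmat e) y y')" by (simp add: mat_mult_def)
  also have "\<dots> = 0" using zero Y by (simp add: EE char_form_eq)
  finally have "of_real (\<Sum>x\<in>V. (cmod (?u x))\<^sup>2) = (0 :: complex)"
    by (simp only: complex_norm_square of_real_sum)
  then have "(\<Sum>x\<in>V. (cmod (?u x))\<^sup>2) = 0" by (simp only: of_real_eq_0_iff)
  then have "(cmod (?u x))\<^sup>2 = 0" using x by (subst (asm) sum_nonneg_eq_0_iff) auto
  then show ?thesis by simp
qed

text \<open>By idempotence the diagonal entry \<open>e 0\<close> is the sum of the squared entries
  of a row, so its vanishing would annihilate the matrix. It is cancelled later when a coefficient
  is extracted.\<close>

lemma idempotent_diag_nonzero: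
  assumes prim: "bmat e \<in> primitive_idempotents V adj"
  shows "e 0 \<noteq> 0"
proof
  assume z: "e 0 = 0"
  have EE: "bmat e **\<^sub>V bmat e = bmat e" and nz: "bmat e \<noteq> (\<lambda>x y. 0)"
    using prim by (auto simp: primitive_idempotents_def nonzero_idempotent_def)
  have "e (ds x y) = 0" if xy: "x \<in> V" "y \<in> V" for x y
  proof -
    have "(\<Sum>y\<in>V. e (ds x y) * cnj (e (ds x y))) = (\<Sum>y\<in>V. e (ds x y) * e (ds x y))"
      using primitive_real[OF prim xy(1)] by (intro sum.cong) auto
    also have "\<dots> = (bmat e **\<^sub>V bmat e) x x" by (rule mm_bmat_diag[OF xy(1), symmetric])
    also have "\<dots> = 0" using EE z xy by simp
    finally have "of_real (\<Sum>y\<in>V. (cmod (e (ds x y)))\<^sup>2) = (0 :: complex)"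
      by (simp only: complex_norm_square of_real_sum)
    then have "(\<Sum>y\<in>V. (cmod (e (ds x y)))\<^sup>2) = 0" by (simp only: of_real_eq_0_iff)
    then have "(cmod (e (ds x y)))\<^sup>2 = 0" using xy by (subst (asm) sum_nonneg_eq_0_iff) auto
    then show ?thesis by simp
  qed
  then have "bmat e = (\<lambda>x y. 0)" by (auto simp: bmat_def fun_eq_iff)
  then show False using nz by simp
qed

end

lemma lagrange_interpolation:
  fixes \<theta> :: "'i \<Rightarrow> 'k::field"
  assumes "finite A" "inj_on \<theta> A"
  obtains p where "\<And>i. i \<in> A \<Longrightarrow> poly p (\<theta> i) = g i"
proof -
  have "\<exists>p. \<forall>i\<in>A. poly p (\<theta> i) = g i" using assms
  proof (induction A rule: finite_induct)
    case (insert k A)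
    then obtain p where p: "\<forall>i\<in>A. poly p (\<theta> i) = g i" by auto
    let ?P = "\<Prod>i\<in>A. [:- \<theta> i, 1:]"
    have nz: "poly ?P (\<theta> k) \<noteq> 0" using insert by (auto simp: poly_prod)
    have "poly (p + smult ((g k - poly p (\<theta> k)) / poly ?P (\<theta> k)) ?P) (\<theta> i) = g i" if "i \<in> insert k A" for i
    proof (cases "i = k")
      case False
      then have "poly ?P (\<theta> i) = 0" using that insert by (auto simp: poly_prod)
      then show ?thesis using p that False by simp
    qed (use nz in simp)
    then show ?case by blast
  qed simp
  then show ?thesis using that by blast
qed

section \<open>Outer distributions in Q-polynomial graphs\<close>

text \<open>\<open>\<theta>\<close> is the sequence of dual eigenvalues. Their distinctness is what
  allows interpolation at them; for classical parameters it is read off from the explicit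
  formula.\<close>

locale qpoly = drg V adj b c for V :: "'v set" and adj b c +
  fixes E :: "nat \<Rightarrow> 'v cmat" and \<theta> :: "nat \<Rightarrow> complex"
  assumes qpol: "Q_polynomial V adj E"
    and E1: "x \<in> V \<Longrightarrow> y \<in> V \<Longrightarrow> of_nat (card V) * E 1 x y = \<theta> (ds x y)"
    and inj: "inj_on \<theta> {..D}"
begin

lemma E_bij: "bij_betw E {..D} (primitive_idempotents V adj)"
  and E_0: "E 0 = (\<lambda>x y. if x \<in> V \<and> y \<in> V then 1 / of_nat (card V) else 0)"
  using qpol by (auto simp: Q_polynomial_def)

lemma E_prim: "i \<le> D \<Longrightarrow> E i \<in> primitive_idempotents V adj"
  using E_bij by (auto dest: bij_betwE)

lemma E_bmat: assumes "i \<le> D" obtains e where "E i = bmat e"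
  using E_prim[OF assms] bose_mesner_iff by (auto simp: primitive_idempotents_def)

lemma E_sym: "i \<le> D \<Longrightarrow> E i x y = E i y x"
  using bmat_sym by (elim E_bmat) simp

lemma card_V_nz: "(of_nat (card V) :: complex) \<noteq> 0"
  using conn by (simp add: connected_graph_def)

text \<open>The Q-polynomial relation scaled by the number of vertices, so that entrywise
  multiplication by \<open>E 1\<close> becomes multiplication by a dual eigenvalue. The nonzero
  \<open>\<gamma> (i + 1)\<close> lets the relation be solved for \<open>E (i + 1)\<close>.\<close>

lemma E_recurrence:
  obtains \<beta> \<alpha> \<gamma> :: "nat \<Rightarrow> complex" where "\<And>i. i < D \<Longrightarrow> \<gamma> (i + 1) \<noteq> 0"
    and "\<And>i x y. i \<le> D \<Longrightarrow> x \<in> V \<Longrightarrow> y \<in> V \<Longrightarrow>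
      \<theta> (ds x y) * E i x y = (if i = 0 then 0 else \<beta> (i - 1) * E (i - 1) x y) + \<alpha> i * E i x y
        + (if i = D then 0 else \<gamma> (i + 1) * E (i + 1) x y)"
proof -
  obtain \<alpha> \<beta> \<gamma> :: "nat \<Rightarrow> complex" where nz: "\<forall>i\<in>{1..D}. \<beta> (i - 1) * \<gamma> i \<noteq> 0" and
    r: "\<forall>i\<le>D. \<forall>x\<in>V. \<forall>y\<in>V. E 1 x y * E i x y = 1 / of_nat (card V) *
             ((if i = 0 then 0 else \<beta> (i - 1) * E (i - 1) x y) + \<alpha> i * E i x y +
              (if i = D then 0 else \<gamma> (i + 1) * E (i + 1) x y))"
    using qpol unfolding Q_polynomial_def by (elim conjE exE) (rule that, assumption+)
  have "\<theta> (ds x y) * E i x y = (if i = 0 then 0 else \<beta> (i - 1) * E (i - 1) x y) + \<alpha> i * E i x y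
        + (if i = D then 0 else \<gamma> (i + 1) * E (i + 1) x y)" (is "_ = ?r")
    if "i \<le> D" "x \<in> V" "y \<in> V" for i x y
  proof -
    have "E 1 x y * E i x y = 1 / of_nat (card V) * ?r" using r that by blast
    then have "of_nat (card V) * (E 1 x y * E i x y) = of_nat (card V) * (1 / of_nat (card V) * ?r)"
      by (rule arg_cong)
    also have "\<dots> = ?r" using card_V_nz by simp
    finally show ?thesis using E1[OF that(2,3)] by (simp only: mult.assoc[symmetric])
  qed
  moreover have "\<gamma> (i + 1) \<noteq> 0" if "i < D" for i
    using bspec[OF nz, of "i + 1"] that by auto
  ultimately show ?thesis using that by blast
qed

text \<open>Solving the three-term recurrence upwards from the constant matrix \<open>E 0\<close>
  raises the degree by at most one per step.\<close>

lemma E_poly: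
  assumes "i \<le> D"
  shows "\<exists>v. degree v \<le> i \<and> (\<forall>x\<in>V. \<forall>y\<in>V. E i x y = poly v (\<theta> (ds x y)))"
  using assms
proof (induction i rule: less_induct)
  case (less i)
  obtain \<alpha> \<beta> \<gamma> :: "nat \<Rightarrow> complex" where nz: "\<And>i. i < D \<Longrightarrow> \<gamma> (i + 1) \<noteq> 0" and
    r: "\<And>i x y. i \<le> D \<Longrightarrow> x \<in> V \<Longrightarrow> y \<in> V \<Longrightarrow>
      \<theta> (ds x y) * E i x y = (if i = 0 then 0 else \<beta> (i - 1) * E (i - 1) x y) + \<alpha> i * E i x y
        + (if i = D then 0 else \<gamma> (i + 1) * E (i + 1) x y)"
    by (rule E_recurrence) blast
  show ?case
  proof (cases i)
    case 0
    then show ?thesis by (intro exI[of _ "[:1 / of_nat (card V):]"]) (simp add: E_0)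
  next
    case (Suc j)
    obtain v where v: "degree v \<le> j" "\<forall>x\<in>V. \<forall>y\<in>V. E j x y = poly v (\<theta> (ds x y))"
      using less.IH[of j] less.prems Suc by auto
    have "\<exists>u. degree u \<le> j - 1 \<and> (\<forall>x\<in>V. \<forall>y\<in>V. E (j - 1) x y = poly u (\<theta> (ds x y)))"
      using less.prems Suc by (intro less.IH) auto
    then obtain u where u: "degree u \<le> j - 1" "\<forall>x\<in>V. \<forall>y\<in>V. E (j - 1) x y = poly u (\<theta> (ds x y))"
      by blast
    define u' where "u' = (if j = 0 then 0 else smult (\<beta> (j - 1)) u)"
    let ?p = "smult (1 / \<gamma> i) ([:0, 1:] * v - smult (\<alpha> j) v - u')"
    have "degree ([:0, 1:] * v) \<le> i" using v(1) Suc degree_mult_le[of "[:0, 1:]" v] by simp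
    moreover have "degree v \<le> i" using v(1) Suc by simp
    moreover have "degree u' \<le> i"
      using u(1) Suc degree_smult_le[of "\<beta> (j - 1)" u] unfolding u'_def by (cases "j = 0") simp_all
    ultimately have "degree ?p \<le> i"
      by (intro order_trans[OF degree_smult_le] degree_diff_le)
    moreover have "E i x y = poly ?p (\<theta> (ds x y))" if "x \<in> V" "y \<in> V" for x y
    proof -
      have "\<theta> (ds x y) * E j x y = poly u' (\<theta> (ds x y)) + \<alpha> j * E j x y + \<gamma> i * E i x y"
        using r[of j x y] less.prems Suc that u(2) unfolding u'_def by (cases "j = 0") simp_all
      then have "\<gamma> i * E i x y = poly ([:0, 1:] * v - smult (\<alpha> j) v - u') (\<theta> (ds x y))"
        using v that by (simp add: algebra_simps)
      moreover have "\<gamma> i \<noteq> 0" using nz[of j] less.prems Suc by simp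
      ultimately show ?thesis by (simp add: field_simps)
    qed
    ultimately show ?thesis by blast
  qed
qed

text \<open>Multiplication by the dual eigenvalues maps the span of the \<open>E i\<close> into
  itself, and the constants are multiples of \<open>E 0\<close>. Hence polynomials in the dual
  eigenvalues stay in the span.\<close>

lemma poly_E:
  "\<exists>\<kappa>. \<forall>x\<in>V. \<forall>y\<in>V. poly p (\<theta> (ds x y)) = (\<Sum>i\<le>D. \<kappa> i * E i x y)"
proof (induction p)
  case 0
  then show ?case by (intro exI[of _ "\<lambda>_. 0"]) simp
next
  case (pCons t p)
  then obtain \<kappa> where \<kappa>: "\<forall>x\<in>V. \<forall>y\<in>V. poly p (\<theta> (ds x y)) = (\<Sum>i\<le>D. \<kappa> i * E i x y)" by blast
  obtain \<alpha> \<beta> \<gamma> :: "nat \<Rightarrow> complex" where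
    r: "\<And>i x y. i \<le> D \<Longrightarrow> x \<in> V \<Longrightarrow> y \<in> V \<Longrightarrow>
      \<theta> (ds x y) * E i x y = (if i = 0 then 0 else \<beta> (i - 1) * E (i - 1) x y) + \<alpha> i * E i x y
        + (if i = D then 0 else \<gamma> (i + 1) * E (i + 1) x y)"
    by (rule E_recurrence) blast
  \<comment> \<open>The tridiagonal matrix of multiplication by the dual eigenvalues in the family
    \<open>E\<close>.\<close>
  define \<mu> where "\<mu> i j = (if i \<noteq> 0 \<and> j = i - 1 then \<beta> (i - 1) else 0) + (if j = i then \<alpha> i else 0)
      + (if i \<noteq> D \<and> j = i + 1 then \<gamma> (i + 1) else 0)" for i j
  have \<mu>: "\<theta> (ds x y) * E i x y = (\<Sum>j\<le>D. \<mu> i j * E j x y)" if "i \<le> D" "x \<in> V" "y \<in> V" for i x y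
  proof -
    have "(\<Sum>j\<le>D. \<mu> i j * E j x y)
      = (\<Sum>j\<le>D. if j = i - 1 then (if i = 0 then 0 else \<beta> (i - 1) * E (i - 1) x y) else 0)
      + (\<Sum>j\<le>D. if j = i then \<alpha> i * E i x y else 0)
      + (\<Sum>j\<le>D. if j = i + 1 then (if i = D then 0 else \<gamma> (i + 1) * E (i + 1) x y) else 0)"
      unfolding sum.distrib[symmetric] by (intro sum.cong) (auto simp: \<mu>_def algebra_simps)
    then show ?thesis using that r[of i x y] by auto
  qed
  \<comment> \<open>The first summand represents the constant \<open>t\<close>, because
    \<open>card V\<close> times \<open>E 0\<close> is the all-ones matrix.\<close>
  define \<kappa>' where "\<kappa>' j = (if j = 0 then t * of_nat (card V) else 0) + (\<Sum>i\<le>D. \<kappa> i * \<mu> i j)" for j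
  have "poly (pCons t p) (\<theta> (ds x y)) = (\<Sum>j\<le>D. \<kappa>' j * E j x y)" if xy: "x \<in> V" "y \<in> V" for x y
  proof -
    have "poly (pCons t p) (\<theta> (ds x y)) = t + \<theta> (ds x y) * (\<Sum>i\<le>D. \<kappa> i * E i x y)"
      using \<kappa> xy by simp
    also have "\<theta> (ds x y) * (\<Sum>i\<le>D. \<kappa> i * E i x y) = (\<Sum>i\<le>D. \<kappa> i * (\<theta> (ds x y) * E i x y))"
      by (simp add: sum_distrib_left algebra_simps)
    also have "\<dots> = (\<Sum>i\<le>D. \<Sum>j\<le>D. \<kappa> i * \<mu> i j * E j x y)"
      using \<mu> xy by (intro sum.cong refl) (simp add: sum_distrib_left mult.assoc)
    also have "\<dots> = (\<Sum>j\<le>D. (\<Sum>i\<le>D. \<kappa> i * \<mu> i j) * E j x y)"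
      by (subst sum.swap) (simp add: sum_distrib_right)
    finally have "poly (pCons t p) (\<theta> (ds x y)) = t + (\<Sum>j\<le>D. (\<Sum>i\<le>D. \<kappa> i * \<mu> i j) * E j x y)" .
    moreover have "t = (\<Sum>j\<le>D. (if j = 0 then t * of_nat (card V) else 0) * E j x y)"
    proof -
      have "(\<Sum>j\<le>D. (if j = 0 then t * of_nat (card V) else 0) * E j x y)
        = (\<Sum>j\<le>D. if j = 0 then t * of_nat (card V) * E 0 x y else 0)" by (intro sum.cong) auto
      then show ?thesis using xy card_V_nz by (simp add: E_0)
    qed
    ultimately show ?thesis by (simp add: \<kappa>'_def sum.distrib distrib_right)
  qed
  then show ?case by blast
qed

text \<open>The quotients of outer distribution by sphere sizes are interpolated by a polynomial and
  expanded in the \<open>E i\<close>. Orthogonality shows that the coefficient of \<open>E i\<close>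
  is, up to the factor \<open>e 0\<close>, the entry at \<open>x\<close> of \<open>E i\<close>
  applied to the characteristic vector. It vanishes beyond the dual width, so only idempotents of
  small degree remain.\<close>

theorem outer_distribution_poly:
  assumes x: "x \<in> V" and Y: "Y \<subseteq> V"
  obtains p where "degree p \<le> dual_width V adj E Y"
    and "\<And>l. l \<le> D \<Longrightarrow> of_nat (card {y\<in>Y. ds x y = l}) = of_nat (card {y\<in>V. ds x y = l}) * poly p (\<theta> l)"
proof -
  let ?a = "\<lambda>l. of_nat (card {y\<in>Y. ds x y = l}) :: complex"
  let ?k = "\<lambda>l. of_nat (card {y\<in>V. ds x y = l}) :: complex"
  let ?w = "dual_width V adj E Y"
  \<comment> \<open>The degree of \<open>g\<close> is not controlled here; the bound appears only
    after re-expressing \<open>g\<close> by the surviving idempotents.\<close>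
  obtain g where g: "\<And>i. i \<in> {..D} \<Longrightarrow> poly g (\<theta> i) = ?a i / ?k i"
    using lagrange_interpolation[OF _ inj, of "\<lambda>i. ?a i / ?k i"] by auto
  have kg: "?k l * poly g (\<theta> l) = ?a l" if "l \<le> D" for l
  proof (cases "{y\<in>V. ds x y = l} = {}")
    case True
    moreover have "{y\<in>Y. ds x y = l} = {}" using True Y by blast
    ultimately show ?thesis by (simp only: card.empty) simp
  next
    case False
    then have "?k l \<noteq> 0" by (subst of_nat_eq_0_iff) auto
    then show ?thesis using g that by simp
  qed
  obtain \<kappa> where \<kappa>: "\<And>x y. x \<in> V \<Longrightarrow> y \<in> V \<Longrightarrow> poly g (\<theta> (ds x y)) = (\<Sum>i\<le>D. \<kappa> i * E i x y)"
    using poly_E[of g] by blast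
  have zero: "\<kappa> i = 0" if i: "i \<le> D" "i > ?w" for i
  proof -
    obtain e where e: "E i = bmat e" by (rule E_bmat[OF i(1)])
    have prim: "bmat e \<in> primitive_idempotents V adj" using E_prim[OF i(1)] e by simp
    have "char_form V Y (E i) = 0"
    proof (rule ccontr)
      assume "char_form V Y (E i) \<noteq> 0"
      then have "i \<le> ?w" unfolding dual_width_def using i by (intro Max_ge) auto
      then show False using i by simp
    qed
    then have "0 = (\<Sum>y\<in>Y. bmat e x y)"
      using char_form_zero_imp_orthogonal[OF prim Y _ x] e by simp
    also have "\<dots> = (\<Sum>y\<in>Y. e (ds x y))" using Y x by (intro sum.cong) auto
    also have "\<dots> = (\<Sum>l\<le>D. ?a l * e l)" by (rule sum_by_dist[OF x Y])
    also have "\<dots> = (\<Sum>l\<le>D. ?k l * (e l * poly g (\<theta> l)))"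
      using kg by (intro sum.cong) (auto simp: algebra_simps)
    also have "\<dots> = (\<Sum>y\<in>V. e (ds x y) * poly g (\<theta> (ds x y)))"
      using sum_by_dist[OF x, of V "\<lambda>l. e l * poly g (\<theta> l)"] by simp
    \<comment> \<open>Symmetry of \<open>E j\<close> turns the row sums into diagonal entries of the
      products of \<open>E i\<close> and \<open>E j\<close>, of which only \<open>j = i\<close>
      survives.\<close>
    also have "\<dots> = (\<Sum>y\<in>V. \<Sum>j\<le>D. \<kappa> j * (E i x y * E j y x))"
      using \<kappa> x e E_sym by (intro sum.cong) (auto simp: sum_distrib_left algebra_simps intro!: sum.cong)
    also have "\<dots> = (\<Sum>j\<le>D. \<kappa> j * (E i **\<^sub>V E j) x x)"
      by (subst sum.swap) (simp add: mat_mult_def sum_distrib_left)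
    also have "\<dots> = (\<Sum>j\<le>D. if j = i then \<kappa> i * E i x x else 0)"
    proof (intro sum.cong refl)
      fix j assume j: "j \<in> {..D}"
      have "E i **\<^sub>V E i = E i"
        using E_prim[OF i(1)] by (auto simp: primitive_idempotents_def nonzero_idempotent_def)
      moreover have "E i **\<^sub>V E j = (\<lambda>x y. 0)" if "j \<noteq> i"
      proof -
        have "E i \<noteq> E j" using E_bij i j that by (auto simp: bij_betw_def inj_on_def)
        then show ?thesis using primitive_orthogonal E_prim i j by auto
      qed
      ultimately show "\<kappa> j * (E i **\<^sub>V E j) x x = (if j = i then \<kappa> i * E i x x else 0)" by auto
    qed
    also have "\<dots> = \<kappa> i * e 0" using i e x by simp
    finally show ?thesis using idempotent_diag_nonzero[OF prim] by simp
  qed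
  have "\<forall>i\<in>{..D}. \<exists>v. degree v \<le> i \<and> (\<forall>x\<in>V. \<forall>y\<in>V. E i x y = poly v (\<theta> (ds x y)))"
    using E_poly by blast
  then obtain v where v: "\<And>i. i \<le> D \<Longrightarrow> degree (v i) \<le> i"
    "\<And>i x y. i \<le> D \<Longrightarrow> x \<in> V \<Longrightarrow> y \<in> V \<Longrightarrow> E i x y = poly (v i) (\<theta> (ds x y))"
    by (auto dest!: bchoice)
  define p where "p = (\<Sum>i\<le>D. smult (\<kappa> i) (v i))"
  have "degree p \<le> ?w" unfolding p_def
  proof (rule degree_sum_le)
    fix i assume "i \<in> {..D}"
    then show "degree (smult (\<kappa> i) (v i)) \<le> ?w"
      using zero[of i] v(1)[of i] degree_smult_le[of "\<kappa> i" "v i"] by (cases "i > ?w") auto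
  qed simp
  moreover have "?a l = ?k l * poly p (\<theta> l)" if l: "l \<le> D" for l
  proof (cases "{y\<in>V. ds x y = l} = {}")
    case True
    moreover have "{y\<in>Y. ds x y = l} = {}" using True Y by blast
    ultimately show ?thesis by (simp only: card.empty) simp
  next
    case False
    then obtain y where y: "y \<in> V" "ds x y = l" by blast
    have "poly g (\<theta> (ds x y)) = poly p (\<theta> (ds x y))"
      using \<kappa>[OF x y(1)] v(2)[OF _ x y(1)] by (simp add: p_def poly_sum)
    then show ?thesis using kg[OF l] y by simp
  qed
  ultimately show ?thesis using that by blast
qed

end

section \<open>q-integers, telescoping products and sphere sizes\<close>

lemma qint_Suc: "qint q (Suc i) = 1 + q * qint q i"
  unfolding qint_def by (subst sum.lessThan_Suc_shift) (simp add: sum_distrib_left)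

lemma qint_0 [simp]: "qint q 0 = 0" and qint_1 [simp]: "qint q (Suc 0) = 1"
  by (simp_all add: qint_def)

lemma qint_add: "qint q (i + j) = qint q i + q ^ i * qint q j"
proof (induction i)
  case (Suc i)
  then show ?case by (simp add: qint_Suc algebra_simps)
qed simp

lemma qint_diff: "i \<le> j \<Longrightarrow> qint q j - qint q i = q ^ i * qint q (j - i)"
  using qint_add[of q i "j - i"] by simp

lemma qint_pos: assumes "q > 0" "i > 0" shows "qint q i > 0"
  unfolding qint_def using assms by (intro sum_pos) auto

lemma qint_less: assumes "q > 0" "i < j" shows "qint q i < qint q j"
proof -
  have "qint q j - qint q i = q ^ i * qint q (j - i)" using assms by (intro qint_diff) simp
  moreover have "qint q (j - i) > 0" using assms by (intro qint_pos) auto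
  ultimately show ?thesis using assms by (metis diff_gt_0_iff_gt mult_pos_pos zero_less_power)
qed

text \<open>Meant for \<open>f j\<close> and \<open>g j\<close> the differences of
  \<open>\<theta> l\<close> and of \<open>\<theta> (Suc l)\<close> with \<open>\<theta> j\<close>,
  and \<open>r = q\<close>: the two products share all but their boundary factors up to powers of
  \<open>r\<close>. The cross-multiplied form avoids division.\<close>

lemma prod_shift_telescope:
  fixes f g :: "nat \<Rightarrow> 'k::comm_ring_1"
  assumes "\<And>j. w \<le> j \<Longrightarrow> j < w + m \<Longrightarrow> g (Suc j) * r = f j"
  shows "(\<Prod>j=Suc w..w + m. g j) * r ^ m * f (w + m) = (\<Prod>j=Suc w..w + m. f j) * f w"
  using assms
proof (induction m)
  case (Suc m)
  have "(\<Prod>j=Suc w..w + Suc m. g j) * r ^ Suc m * f (w + Suc m)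
      = (\<Prod>j=Suc w..w + m. g j) * r ^ m * (g (Suc (w + m)) * r) * f (w + Suc m)"
    by (simp add: algebra_simps)
  also have "\<dots> = (\<Prod>j=Suc w..w + m. g j) * r ^ m * f (w + m) * f (w + Suc m)"
    using Suc.prems[of "w + m"] by simp
  also have "\<dots> = (\<Prod>j=Suc w..w + m. f j) * f w * f (w + Suc m)" using Suc by simp
  finally show ?case by (simp add: algebra_simps)
qed simp

context drg
begin

lemma sum_card_swap:
  assumes "finite A" "finite B"
  shows "(\<Sum>y\<in>A. card {z\<in>B. R y z}) = (\<Sum>z\<in>B. card {y\<in>A. R y z})"
  using assms by (intro sum_multicount_gen) auto

text \<open>Double counting of the edges between two consecutive spheres around
  \<open>x\<close>.\<close>

lemma card_sphere_rec:
  assumes x: "x \<in> V"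
  shows "card {y\<in>V. ds x y = Suc l} * c (Suc l) = card {y\<in>V. ds x y = l} * b l"
proof -
  let ?L = "\<lambda>l. {y\<in>V. ds x y = l}"
  have "card (?L l) * b l = (\<Sum>y\<in>?L l. card {z\<in>?L (Suc l). adj y z})"
  proof -
    have "card {z\<in>?L (Suc l). adj y z} = b l" if "y \<in> ?L l" for y
      using card_up[OF x, of y] that by (auto simp: conj_ac)
    then show ?thesis by simp
  qed
  also have "\<dots> = (\<Sum>z\<in>?L (Suc l). card {y\<in>?L l. adj y z})" by (rule sum_card_swap) auto
  also have "\<dots> = card (?L (Suc l)) * c (Suc l)"
  proof -
    have "card {y\<in>?L l. adj y z} = c (Suc l)" if z: "z \<in> ?L (Suc l)" for z
    proof -
      have "{y\<in>?L l. adj y z} = {y\<in>V. adj z y \<and> ds x y + 1 = ds x z}" using z adj_sym by auto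
      then show ?thesis using card_down[OF x, of z] z by simp
    qed
    then show ?thesis by simp
  qed
  finally show ?thesis by simp
qed

end

section \<open>Descendents in graphs with classical parameters (d, q, 0, 1)\<close>

locale classical01 = qpoly V adj b c E \<theta>
  for V :: "'v set" and adj b c E \<theta> +
  fixes d :: nat and q :: real and \<xi> \<zeta> :: complex
  assumes diam: "graph_diameter V adj = d" and q: "q > 1"
    and b: "i \<le> d \<Longrightarrow> real (b i) = qint q d - qint q i"
    and c: "i \<le> d \<Longrightarrow> real (c i) = qint q i"
    and \<xi>: "\<xi> \<noteq> 0" and \<theta>: "i \<le> d \<Longrightarrow> \<theta> i = \<xi> * of_real (qint q (d - i)) + \<zeta>"
begin

lemma dist_le_d: "x \<in> V \<Longrightarrow> y \<in> V \<Longrightarrow> ds x y \<le> d"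
  using dist_le_D diam by simp

text \<open>For these parameters \<open>b i + c i\<close> equals the valency \<open>b 0\<close>, so
  no neighbour of \<open>y\<close> is left over at the same distance from \<open>x\<close>.\<close>

lemma bipartite:
  assumes x: "x \<in> V" and yz: "adj y z"
  shows "ds x z = ds x y + 1 \<or> ds x z + 1 = ds x y"
proof -
  let ?U = "{z\<in>V. adj y z \<and> ds x z = ds x y + 1}" and ?W = "{z\<in>V. adj y z \<and> ds x z + 1 = ds x y}"
  have y: "y \<in> V" using yz adj_in by blast
  have "real (card ?U) + real (card ?W) = qint q d"
    using card_up[OF x y] card_down[OF x y] b[OF dist_le_d[OF x y]] c[OF dist_le_d[OF x y]] by simp
  also have "\<dots> = real (card {z\<in>V. adj y z})" using card_nbrs[OF y] b[of 0] by simp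
  finally have "card {z\<in>V. adj y z} = card ?U + card ?W" by simp
  also have "\<dots> = card (?U \<union> ?W)" by (intro card_Un_disjoint[symmetric]) auto
  finally have "?U \<union> ?W = {z\<in>V. adj y z}" by (intro card_subset_eq) auto
  then show ?thesis using yz adj_in by blast
qed

lemma sphere_pos: assumes "x \<in> V" "l \<le> d" shows "card {y\<in>V. ds x y = l} > 0"
  using assms(2)
proof (induction l)
  case 0
  have "x \<in> {y\<in>V. ds x y = 0}" using assms by simp
  then show ?case by (subst card_gt_0_iff) auto
next
  case (Suc l)
  have "real (b l) > 0" using b[of l] qint_less[of q l d] Suc q by simp
  then have "card {y\<in>V. ds x y = l} * b l > 0" using Suc by simp
  then show ?case unfolding card_sphere_rec[OF assms(1), symmetric] nat_0_less_mult_iff by blast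
qed

end

locale classical01_descendent = classical01 V adj b c E \<theta> d q \<xi> \<zeta>
  for V :: "'v set" and adj b c E \<theta> d q \<xi> \<zeta> +
  fixes Y :: "'v set"
  assumes desc: "descendent V adj E Y"
begin

abbreviation "w \<equiv> graph_width V adj Y"
abbreviation "a x l \<equiv> card {y\<in>Y. ds x y = l}"

lemma Y_V: "Y \<subseteq> V" and Y_ne: "Y \<noteq> {}" and w_dual: "w + dual_width V adj E Y = d"
  using desc diam by (auto simp: descendent_def)

lemma Y_in: "x \<in> Y \<Longrightarrow> x \<in> V" using Y_V by blast

lemma finY [simp]: "finite Y" using Y_V finV finite_subset by blast

lemma w_le: "w \<le> d" using w_dual by simp

lemma dist_le_w: assumes "x \<in> Y" "y \<in> Y" shows "ds x y \<le> w"
proof -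
  let ?i = "ds x y"
  have xy: "x \<in> V" "y \<in> V" using assms Y_in by auto
  have "char_form V Y (dist_mat V adj ?i) = (\<Sum>u\<in>Y. \<Sum>v\<in>Y. if ds u v = ?i then 1 else 0)"
    unfolding char_form_eq[OF Y_V] using Y_in by (intro sum.cong) (auto simp: dist_mat_def)
  also have "\<dots> = of_nat (\<Sum>u\<in>Y. \<Sum>v\<in>Y. if ds u v = ?i then 1 else 0)"
    unfolding of_nat_sum by (intro sum.cong) auto
  finally have "char_form V Y (dist_mat V adj ?i) = of_nat (\<Sum>u\<in>Y. \<Sum>v\<in>Y. if ds u v = ?i then 1 else 0)" .
  moreover have "(\<Sum>u\<in>Y. \<Sum>v\<in>Y. if ds u v = ?i then 1 else 0) \<noteq> (0 :: nat)"
  proof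
    assume "(\<Sum>u\<in>Y. \<Sum>v\<in>Y. if ds u v = ?i then 1 else 0) = (0 :: nat)"
    then have "(\<Sum>v\<in>Y. if ds x v = ?i then 1 else 0) = (0 :: nat)"
      using assms by (subst (asm) sum_eq_0_iff) (rule finY, blast)
    then have "(if ds x y = ?i then 1 else 0) = (0 :: nat)"
      using assms by (subst (asm) sum_eq_0_iff) (rule finY, blast)
    then show False by simp
  qed
  ultimately have "char_form V Y (dist_mat V adj ?i) \<noteq> 0" by (simp only: of_nat_eq_0_iff not_False_eq_True)
  then show ?thesis unfolding graph_width_def using dist_le_D[OF xy] by (intro Max_ge) auto
qed

text \<open>The polynomial from \<open>outer_distribution_poly\<close> has degree at most
  \<open>d - w\<close> and vanishes at the \<open>d - w\<close> points \<open>\<theta> j\<close>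
  with \<open>j > w\<close>, where \<open>Y\<close> has no vertices but the spheres of the graph are
  nonempty. It is thus a multiple of the product of the linear factors.\<close>

lemma inner_distribution:
  assumes x: "x \<in> Y"
  obtains t where "\<And>l. l \<le> d \<Longrightarrow>
    of_nat (a x l) = t * of_nat (card {y\<in>V. ds x y = l}) * (\<Prod>j=Suc w..d. \<theta> l - \<theta> j)"
proof -
  have xV: "x \<in> V" using x Y_in by blast
  let ?k = "\<lambda>l. card {y\<in>V. ds x y = l}"
  obtain p where deg: "degree p \<le> dual_width V adj E Y"
    and p': "\<And>l. l \<le> D \<Longrightarrow> of_nat (a x l) = of_nat (?k l) * poly p (\<theta> l)"
    using outer_distribution_poly[OF xV Y_V] by blast
  note p = p'[unfolded diam]
  let ?P = "\<Prod>j=Suc w..d. [:- \<theta> j, 1:]"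
  have inj_eq: "\<theta> i = \<theta> j \<longleftrightarrow> i = j" if "i \<le> d" "j \<le> d" for i j
    using inj diam that by (auto simp: inj_on_def)
  have "degree ?P = (\<Sum>j=Suc w..d. degree [:- \<theta> j, 1:])" by (rule degree_prod_eq_sum_degree) simp
  then have degP: "degree ?P = d - w" by simp
  have P: "poly ?P s = (\<Prod>j=Suc w..d. s - \<theta> j)" for s by (simp add: poly_prod)
  have nz: "poly ?P (\<theta> 0) \<noteq> 0" unfolding P using inj_eq[of 0] by auto
  define t where "t = poly p (\<theta> 0) / poly ?P (\<theta> 0)"
  \<comment> \<open>The \<open>d - w\<close> roots together with \<open>\<theta> 0\<close>, which
    fixes the scalar \<open>t\<close>: one more node than the degree bound.\<close>
  let ?A = "\<theta> ` insert 0 {Suc w..d}"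
  have "card ?A = card (insert 0 {Suc w..d})"
    by (rule card_image) (auto simp: inj_on_def inj_eq)
  then have cardA: "card ?A = d - w + 1" by simp
  have "p = smult t ?P"
  proof (rule poly_eqI_degree)
    fix s assume "s \<in> ?A"
    then consider "s = \<theta> 0" | j where "s = \<theta> j" "Suc w \<le> j" "j \<le> d" by auto
    then show "poly p s = poly (smult t ?P) s"
    proof cases
      case 1
      then show ?thesis using nz by (simp add: t_def)
    next
      case (2 j)
      have "{y\<in>Y. ds x y = j} = {}" using dist_le_w[OF x] 2 by fastforce
      then have "a x j = 0" by (simp only: card.empty)
      then have "of_nat (?k j) * poly p (\<theta> j) = 0" using p[of j] 2 by (simp only: of_nat_0)
      moreover have "of_nat (?k j) \<noteq> (0 :: complex)"
        unfolding of_nat_eq_0_iff using sphere_pos[OF xV, of j] 2 by blast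
      ultimately have "poly p (\<theta> j) = 0" unfolding mult_eq_0_iff by blast
      moreover have "poly ?P (\<theta> j) = 0" unfolding P using 2 by (intro prod_zero) auto
      ultimately show ?thesis using 2 by simp
    qed
  next
    show "degree p < card ?A" using deg w_dual cardA by simp
    show "degree (smult t ?P) < card ?A"
      using degree_smult_le[of t ?P] degP cardA by simp
  qed
  then have "poly p s = t * (\<Prod>j=Suc w..d. s - \<theta> j)" for s using P by simp
  then show ?thesis using that[of t] p by (simp add: algebra_simps)
qed

text \<open>This is the sphere recurrence of a graph with parameters \<open>(w, q, 0, 1)\<close>. It
  combines the recurrence of the ambient spheres with the quotient of the products in
  \<open>inner_distribution\<close>, which telescopes.\<close>

lemma inner_distribution_rec:
  assumes x: "x \<in> Y" and l: "l < w"
  shows "real (a x (Suc l)) * qint q (Suc l) = real (a x l) * (qint q w - qint q l)"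
proof -
  have xV: "x \<in> V" using x Y_in by blast
  define k where "k l = card {y\<in>V. ds x y = l}" for l
  define \<alpha> where "\<alpha> l = a x l" for l
  let ?Q = "\<lambda>i. complex_of_real (qint q i)"
  obtain t where t: "\<And>l. l \<le> d \<Longrightarrow> of_nat (\<alpha> l) = t * of_nat (k l) * (\<Prod>j=Suc w..d. \<theta> l - \<theta> j)"
    using inner_distribution[OF x] unfolding k_def \<alpha>_def by blast
  define F where "F = (\<Prod>j=Suc w..d. \<theta> l - \<theta> j)"
  define G where "G = (\<Prod>j=Suc w..d. \<theta> (Suc l) - \<theta> j)"
  define m where "m = d - w"
  have d: "d = w + m" using w_le m_def by simp
  have ld: "l < d" using l w_le by simp
  have "k (Suc l) * c (Suc l) = k l * b l" using card_sphere_rec[OF xV] by (simp only: k_def)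
  then have "real (k (Suc l)) * real (c (Suc l)) = real (k l) * real (b l)" by (metis of_nat_mult)
  then have "real (k (Suc l)) * qint q (Suc l) = real (k l) * (qint q d - qint q l)"
    using b[of l] c[of "Suc l"] ld by simp
  from arg_cong[OF this, of complex_of_real]
  have krec: "of_nat (k (Suc l)) * ?Q (Suc l) = of_nat (k l) * (?Q d - ?Q l)" by simp
  have diff: "\<theta> l - \<theta> j = \<xi> * of_real q ^ (d - j) * ?Q (j - l)" if "l \<le> j" "j \<le> d" for j
  proof -
    have "qint q (d - l) - qint q (d - j) = q ^ (d - j) * qint q (j - l)"
      using qint_diff[of "d - j" "d - l" q] that by simp
    from arg_cong[OF this, of complex_of_real]
    have "?Q (d - l) - ?Q (d - j) = of_real q ^ (d - j) * ?Q (j - l)" by simp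
    moreover have "\<theta> l - \<theta> j = \<xi> * (?Q (d - l) - ?Q (d - j))"
      using \<theta>[of l] \<theta>[of j] that by (simp add: algebra_simps)
    ultimately show ?thesis by simp
  qed
  \<comment> \<open>Raising both indices by one divides a difference of dual eigenvalues by
    \<open>q\<close>.\<close>
  have "(\<Prod>j=Suc w..w + m. \<theta> (Suc l) - \<theta> j) * of_real q ^ m * (\<theta> l - \<theta> (w + m))
      = (\<Prod>j=Suc w..w + m. \<theta> l - \<theta> j) * (\<theta> l - \<theta> w)"
  proof (rule prod_shift_telescope)
    fix j assume j: "w \<le> j" "j < w + m"
    have "Suc (d - Suc l) = d - l" "Suc (d - Suc j) = d - j" using j ld d by auto
    then have "qint q (d - l) = 1 + q * qint q (d - Suc l)" "qint q (d - j) = 1 + q * qint q (d - Suc j)"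
      using qint_Suc[of q "d - Suc l"] qint_Suc[of q "d - Suc j"] by simp_all
    moreover have "l \<le> d" "j \<le> d" "Suc l \<le> d" "Suc j \<le> d" using j ld d by auto
    ultimately show "(\<theta> (Suc l) - \<theta> (Suc j)) * of_real q = \<theta> l - \<theta> j"
      using \<theta>[of l] \<theta>[of j] \<theta>[of "Suc l"] \<theta>[of "Suc j"] by (simp add: algebra_simps)
  qed
  then have "G * of_real q ^ m * (\<theta> l - \<theta> d) = F * (\<theta> l - \<theta> w)"
    unfolding F_def G_def d[symmetric] .
  moreover have "\<theta> l - \<theta> d = \<xi> * ?Q (d - l)" using diff[of d] ld by simp
  moreover have "\<theta> l - \<theta> w = \<xi> * of_real q ^ m * ?Q (w - l)"
    using diff[of w] l w_le by (simp add: m_def)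
  ultimately have "\<xi> * of_real q ^ m * (G * ?Q (d - l)) = \<xi> * of_real q ^ m * (F * ?Q (w - l))"
    by (simp add: algebra_simps)
  moreover have "\<xi> * of_real q ^ m \<noteq> 0" using \<xi> q by simp
  ultimately have GF: "G * ?Q (d - l) = F * ?Q (w - l)" by (rule mult_left_cancel[THEN iffD1, rotated])
  have hd: "?Q d - ?Q l = of_real q ^ l * ?Q (d - l)"
    using arg_cong[OF qint_diff[of l d q], of complex_of_real] ld by simp
  have hw: "?Q w - ?Q l = of_real q ^ l * ?Q (w - l)"
    using arg_cong[OF qint_diff[of l w q], of complex_of_real] l by simp
  have "of_nat (\<alpha> (Suc l)) * ?Q (Suc l) = t * (of_nat (k (Suc l)) * ?Q (Suc l)) * G"
    using t[of "Suc l"] ld by (simp add: G_def algebra_simps)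
  also have "\<dots> = t * of_nat (k l) * of_real q ^ l * (G * ?Q (d - l))"
    unfolding krec hd by (simp add: algebra_simps)
  also have "\<dots> = (t * of_nat (k l) * F) * (of_real q ^ l * ?Q (w - l))"
    unfolding GF by (simp add: algebra_simps)
  also have "\<dots> = of_nat (\<alpha> l) * (?Q w - ?Q l)"
    using t[of l] ld by (simp add: hw F_def)
  finally have "complex_of_real (real (\<alpha> (Suc l)) * qint q (Suc l))
      = complex_of_real (real (\<alpha> l) * (qint q w - qint q l))"
    by simp
  then show ?thesis unfolding \<alpha>_def by (simp only: of_real_eq_iff)
qed

lemma card_nbrs_in:
  assumes y: "y \<in> Y" and w: "0 < w" shows "real (card {z\<in>Y. adj y z}) = qint q w"
proof -
  have "ds y z = 0 \<longleftrightarrow> y = z" if "z \<in> Y" for z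
    by (rule dist_0[OF Y_in[OF y] Y_in[OF that]])
  then have "{z\<in>Y. ds y z = 0} = {z\<in>Y. y = z}" by (intro Collect_cong) (simp cong: conj_cong)
  also have "\<dots> = {y}" using y by blast
  finally have "{z\<in>Y. ds y z = 0} = {y}" .
  then have 0: "a y 0 = 1" by simp
  have "ds y z = 1 \<longleftrightarrow> adj y z" if "z \<in> Y" for z
    by (rule dist_1[OF Y_in[OF y] Y_in[OF that]])
  then have 1: "{z\<in>Y. adj y z} = {z\<in>Y. ds y z = Suc 0}"
    by (intro Collect_cong) (simp cong: conj_cong)
  show ?thesis using inner_distribution_rec[OF y w] unfolding 0 1 by simp
qed

lemma card_down_in_le:
  assumes "x \<in> Y" "y \<in> Y"
  shows "real (card {z\<in>Y. adj y z \<and> ds x z + 1 = ds x y}) \<le> qint q (ds x y)"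
proof -
  have V: "x \<in> V" "y \<in> V" using assms Y_in by auto
  have "card {z\<in>Y. adj y z \<and> ds x z + 1 = ds x y} \<le> card {z\<in>V. adj y z \<and> ds x z + 1 = ds x y}"
    using Y_in by (intro card_mono) auto
  then show ?thesis using card_down[OF V] c[OF dist_le_d[OF V]] by simp
qed

text \<open>By bipartiteness each of the \<open>qint q w\<close> neighbours of \<open>y\<close>
  inside \<open>Y\<close> goes up or down, and the ambient graph bounds the number going
  down.\<close>

lemma card_up_in_ge:
  assumes x: "x \<in> Y" and y: "y \<in> Y" and w: "0 < w"
  shows "real (card {z\<in>Y. adj y z \<and> ds x z = ds x y + 1}) \<ge> qint q w - qint q (ds x y)"
proof -
  let ?U = "{z\<in>Y. adj y z \<and> ds x z = ds x y + 1}" and ?W = "{z\<in>Y. adj y z \<and> ds x z + 1 = ds x y}"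
  have "{z\<in>Y. adj y z} = ?U \<union> ?W" using bipartite[of x y] Y_in[OF x] by blast
  then have "card {z\<in>Y. adj y z} \<le> card ?U + card ?W" by (simp only: card_Un_le)
  then show ?thesis using card_nbrs_in[OF y w] card_down_in_le[OF x y] by linarith
qed

text \<open>Geodesics inside \<open>Y\<close> can be prolonged until they have length
  \<open>w\<close>.\<close>

lemma up_nbr:
  assumes "x \<in> Y" "y \<in> Y" "ds x y < w"
  obtains z where "z \<in> Y" "adj y z" "ds x z = ds x y + 1"
proof -
  have "qint q w - qint q (ds x y) > 0" using qint_less[OF _ assms(3)] q by simp
  moreover have "0 < w" using assms(3) by simp
  ultimately have "0 < real (card {z\<in>Y. adj y z \<and> ds x z = ds x y + 1})"
    using card_up_in_ge[OF assms(1,2)] by linarith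
  then have "{z\<in>Y. adj y z \<and> ds x z = ds x y + 1} \<noteq> {}"
    unfolding of_nat_0_less_iff card_gt_0_iff by blast
  then show ?thesis using that by blast
qed

text \<open>
  Counting edges of \<open>Y\<close> between consecutive spheres around \<open>x\<close> from both sides, the bounds
  \<open>card_down_in_le\<close> and \<open>card_up_in_ge\<close> are forced to be equalities by the recurrence for the
  inner distribution.
\<close>
theorem convex:
  assumes x: "x \<in> Y" and y: "y \<in> Y" and yz: "adj y z" and dz: "ds x z + 1 = ds x y"
  shows "z \<in> Y"
proof -
  define l where "l = ds x z"
  let ?L = "\<lambda>l. {y\<in>Y. ds x y = l}"
  have lw: "l < w" using dist_le_w[OF x y] dz l_def by simp
  have dn: "{u\<in>?L l. adj u v} = {u\<in>Y. adj v u \<and> ds x u + 1 = ds x v}" if "v \<in> ?L (Suc l)" for v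
    using that adj_sym by auto
  have le: "real (card {u\<in>?L l. adj u v}) \<le> qint q (Suc l)" if "v \<in> ?L (Suc l)" for v
    unfolding dn[OF that] using card_down_in_le[OF x, of v] that by simp
  have "real (a x l) * (qint q w - qint q l) \<le> (\<Sum>u\<in>?L l. real (card {v\<in>?L (Suc l). adj u v}))"
  proof -
    have "(\<Sum>u\<in>?L l. qint q w - qint q l) \<le> (\<Sum>u\<in>?L l. real (card {v\<in>?L (Suc l). adj u v}))"
    proof (intro sum_mono)
      fix u assume u: "u \<in> ?L l"
      have "{v\<in>?L (Suc l). adj u v} = {v\<in>Y. adj u v \<and> ds x v = ds x u + 1}" using u by auto
      then show "qint q w - qint q l \<le> real (card {v\<in>?L (Suc l). adj u v})"
        using card_up_in_ge[OF x, of u] u lw by simp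
    qed
    then show ?thesis by simp
  qed
  also have "\<dots> = real (\<Sum>u\<in>?L l. card {v\<in>?L (Suc l). adj u v})" by simp
  also have "(\<Sum>u\<in>?L l. card {v\<in>?L (Suc l). adj u v}) = (\<Sum>v\<in>?L (Suc l). card {u\<in>?L l. adj u v})"
    by (rule sum_card_swap) auto
  finally have ge: "(\<Sum>v\<in>?L (Suc l). qint q (Suc l)) \<le> (\<Sum>v\<in>?L (Suc l). real (card {u\<in>?L l. adj u v}))"
    using inner_distribution_rec[OF x lw] by simp
  have yL: "y \<in> ?L (Suc l)" using y dz l_def by simp
  have "real (card {u\<in>?L l. adj u y}) = qint q (Suc l)"
  proof (rule ccontr)
    assume "real (card {u\<in>?L l. adj u y}) \<noteq> qint q (Suc l)"
    then have "real (card {u\<in>?L l. adj u y}) < qint q (Suc l)" using le[OF yL] by simp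
    then have "(\<Sum>v\<in>?L (Suc l). real (card {u\<in>?L l. adj u v})) < (\<Sum>v\<in>?L (Suc l). qint q (Suc l))"
      using yL le by (intro sum_strict_mono_ex1) auto
    then show False using ge by simp
  qed
  \<comment> \<open>Equality with the ambient number \<open>c (Suc l)\<close> means that all
    neighbours of \<open>y\<close> closer to \<open>x\<close> lie in \<open>Y\<close>, in particular
    \<open>z\<close>.\<close>
  then have "real (card {u\<in>Y. adj y u \<and> ds x u + 1 = ds x y}) = real (card {u\<in>V. adj y u \<and> ds x u + 1 = ds x y})"
    unfolding dn[OF yL] using card_down[OF Y_in[OF x] Y_in[OF y]] c[of "Suc l"] lw w_le dz l_def by simp
  then have "{u\<in>Y. adj y u \<and> ds x u + 1 = ds x y} = {u\<in>V. adj y u \<and> ds x u + 1 = ds x y}"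
    using Y_in by (intro card_subset_eq) auto
  then show ?thesis using yz dz adj_in by blast
qed

end

text \<open>Passage from the definitions to the locale. Distinctness of the dual eigenvalues comes
  from the strict monotonicity of \<open>qint\<close>.\<close>

lemma standard_ordering_classical01:
  assumes so: "standard_ordering V adj d q 0 1 E" and q: "q > 1"
  obtains b c \<theta> \<xi> \<zeta> where "classical01 V adj b c E \<theta> d q \<xi> \<zeta>"
proof -
  have dr: "distance_regular V adj" and dia: "graph_diameter V adj = d" and Q: "Q_polynomial V adj E"
    using so by (auto simp: standard_ordering_def classical_parameters_def)
  obtain b c where bc: "intersection_numbers V adj b c"
      "\<forall>i\<le>d. real (b i) = qint q d - qint q i \<and> real (c i) = qint q i"
    using so by (auto simp: standard_ordering_def classical_parameters_def)
  interpret drg V adj b c using dr bc by unfold_locales (auto simp: distance_regular_def)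
  obtain \<theta> :: "nat \<Rightarrow> complex" and \<xi> \<zeta> where
    E1: "\<forall>x\<in>V. \<forall>y\<in>V. of_nat (card V) * E 1 x y = (\<Sum>i\<le>d. \<theta> i * dist_mat V adj i x y)"
    and nz: "\<xi> \<noteq> 0" and th: "\<forall>i\<le>d. \<theta> i = \<xi> * of_real (qint q (d - i)) + \<zeta>"
    using so unfolding standard_ordering_def by blast
  have "classical01 V adj b c E \<theta> d q \<xi> \<zeta>"
  proof unfold_locales
    show "Q_polynomial V adj E" by (rule Q)
    show "of_nat (card V) * E 1 x y = \<theta> (graph_dist adj x y)" if "x \<in> V" "y \<in> V" for x y
    proof -
      have "(\<Sum>i\<le>d. \<theta> i * dist_mat V adj i x y) = bmat \<theta> x y"
        using fun_cong[OF fun_cong[OF sum_dist_mat[of \<theta>]]] dia by simp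
      then show ?thesis using E1 that by simp
    qed
    show "inj_on \<theta> {..graph_diameter V adj}"
    proof (rule inj_onI)
      fix i j assume "i \<in> {..graph_diameter V adj}" "j \<in> {..graph_diameter V adj}" and eq: "\<theta> i = \<theta> j"
      then have ij: "i \<le> d" "j \<le> d" using dia by auto
      then have "qint q (d - i) = qint q (d - j)" using eq th nz by simp
      then have "d - i = d - j" using q qint_less[of q "d - i" "d - j"] qint_less[of q "d - j" "d - i"]
        by (cases "d - i" "d - j" rule: linorder_cases) auto
      then show "i = j" using ij by simp
    qed
  qed (use dia q bc nz th in auto)
  then show ?thesis using that by blast
qed

section \<open>Symplectic spaces\<close>

text \<open>If \<open>2 = 0\<close>, then adding \<open>1\<close> is an involution without fixed
  points, which pairs off the elements of the field.\<close>

lemma two_neq_zero_if_odd_card: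
  assumes "odd CARD('a::{field,finite})" shows "(2 :: 'a) \<noteq> 0"
proof
  assume "(2 :: 'a) = 0"
  then have "x + 1 + 1 = x" for x :: 'a by (simp add: add.assoc)
  then have "\<exists>f :: 'a \<Rightarrow> 'a. (\<forall>x. f (f x) = x) \<and> (\<forall>x. f x \<noteq> x)"
    by (intro exI[of _ "\<lambda>x. x + 1"]) simp
  then obtain f :: "'a \<Rightarrow> 'a" where f: "\<And>x. f (f x) = x" "\<And>x. f x \<noteq> x" by blast
  let ?C = "range (\<lambda>x. {x, f x})"
  have "2 * card ?C = card (\<Union> ?C)"
  proof (rule card_partition)
    fix s t assume "s \<in> ?C" "t \<in> ?C" and ne: "s \<noteq> t"
    then obtain x y where xy: "s = {x, f x}" "t = {y, f y}" by blast
    have "x \<noteq> y" "x \<noteq> f y" "f x \<noteq> y" using ne xy f(1) by auto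
    moreover have "f x \<noteq> f y" using \<open>x \<noteq> y\<close> f(1)[of x] f(1)[of y] by auto
    ultimately show "s \<inter> t = {}" using xy by auto
  next
    show "card s = 2" if "s \<in> ?C" for s
      using that f(2) by (auto simp: card_insert_if eq_commute)
  qed auto
  also have "\<Union> ?C = UNIV" by blast
  finally show False using assms by presburger
qed

lemma vec_subset_dim_eq:
  fixes S T :: "('a::field ^ 'n) set"
  assumes "vec.subspace S" "vec.subspace T" "S \<subseteq> T" "vec.dim T \<le> vec.dim S"
  shows "S = T"
  using vec.subspace_dim_equal assms by blast

lemma notin_span_subspace: "vec.subspace S \<Longrightarrow> v \<notin> S \<Longrightarrow> v \<notin> vec.span S"
  using vec.span_minimal[of S S] by blast

locale symplectic =
  fixes B :: "'a::field ^ 'n \<Rightarrow> 'a ^ 'n \<Rightarrow> 'a" and n :: nat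
  assumes form: "symplectic_form B" and dimV: "CARD('n) = 2 * n"
begin

lemma linR: "Vector_Spaces.linear (*s) (*) (\<lambda>v. B u v)"
  and linL: "Vector_Spaces.linear (*s) (*) (\<lambda>u. B u v)"
  and alt [simp]: "B v v = 0" and nondeg: "(\<And>v. B u v = 0) \<Longrightarrow> u = 0"
  using form by (auto simp: symplectic_form_def)

lemma addR: "B u (v + w) = B u v + B u w" and scaleR: "B u (s *s v) = s * B u v"
  using linR[of u] by (auto simp: Vector_Spaces.linear_iff)

lemma addL: "B (u + v) w = B u w + B v w" and scaleL: "B (s *s u) w = s * B u w"
  using linL[of w] by (auto simp: Vector_Spaces.linear_iff)

lemma skew: "B v u = - B u v"
proof -
  have "B (u + v) (u + v) = B u v + B v u" unfolding addL addR by simp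
  then have "B u v + B v u = 0" by simp
  then show ?thesis by (simp add: add_eq_0_iff)
qed

lemma zeroR [simp]: "B u 0 = 0" using scaleR[of u 0 0] by simp
lemma zeroL [simp]: "B 0 u = 0" using scaleL[of 0 0 u] by simp

lemma diffR: "B u (v - w) = B u v - B u w"
  using addR[of u "v - w" w] by simp

lemma subspace_perp: "vec.subspace {v. B a v = 0}"
  by (auto simp: vec.subspace_def addR scaleR)

lemma isotropic_span:
  assumes "\<And>x y. x \<in> S \<Longrightarrow> y \<in> S \<Longrightarrow> B x y = 0"
  shows "isotropic B (vec.span S)"
proof -
  have 1: "B x y = 0" if "x \<in> S" "y \<in> vec.span S" for x y
    using vec.span_minimal[OF _ subspace_perp[of x], of S] assms that by blast
  have "B y x = 0" if "x \<in> vec.span S" "y \<in> vec.span S" for x y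
  proof -
    have "S \<subseteq> {v. B y v = 0}" using 1[OF _ that(2)] skew[of _ y] by auto
    then show ?thesis using vec.span_minimal[OF _ subspace_perp[of y], of S] that(1) by blast
  qed
  then show ?thesis by (auto simp: isotropic_def)
qed

text \<open>If \<open>B a\<close> does not vanish on \<open>S\<close>, every vector of
  \<open>S\<close> can be moved into the kernel by subtracting a multiple of one fixed
  \<open>e\<close>.\<close>

lemma dim_inter_perp:
  assumes "vec.subspace S"
  shows "vec.dim S \<le> vec.dim (S \<inter> {v. B a v = 0}) + 1"
proof (cases "S \<subseteq> {v. B a v = 0}")
  case True
  then have "S \<inter> {v. B a v = 0} = S" by blast
  then show ?thesis by simp
next
  case False
  then obtain e where e: "e \<in> S" "B a e \<noteq> 0" by blast
  have "S \<subseteq> vec.span (insert e (S \<inter> {v. B a v = 0}))"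
  proof
    fix v assume v: "v \<in> S"
    let ?v = "v - (B a v / B a e) *s e"
    have "?v \<in> S \<inter> {v. B a v = 0}"
      using v e assms by (auto simp: diffR scaleR vec.subspace_diff vec.subspace_scale)
    then show "v \<in> vec.span (insert e (S \<inter> {v. B a v = 0}))"
      using vec.in_span_insert vec.span_breakdown_eq vec.span_base by metis
  qed
  then have "vec.dim S \<le> vec.dim (insert e (S \<inter> {v. B a v = 0}))" by (rule vec.dim_mono)
  also have "\<dots> \<le> vec.dim (S \<inter> {v. B a v = 0}) + 1" by (simp add: vec.dim_insert)
  finally show ?thesis .
qed

lemma dim_inter_perp_set:
  assumes "finite A" "vec.subspace S"
  shows "vec.dim S \<le> vec.dim (S \<inter> {v. \<forall>a\<in>A. B a v = 0}) + card A"
  using assms(1)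
proof (induction A rule: finite_induct)
  case (insert a A)
  let ?T = "S \<inter> {v. \<forall>a\<in>A. B a v = 0}"
  have "vec.subspace ?T" using assms(2) by (auto simp: vec.subspace_def addR scaleR)
  then have "vec.dim ?T \<le> vec.dim (?T \<inter> {v. B a v = 0}) + 1" by (rule dim_inter_perp)
  moreover have "?T \<inter> {v. B a v = 0} = S \<inter> {v. \<forall>a\<in>insert a A. B a v = 0}" by auto
  ultimately show ?case using insert by simp
qed simp

lemma isotropicD: "isotropic B u \<Longrightarrow> x \<in> u \<Longrightarrow> y \<in> u \<Longrightarrow> B x y = 0"
  and isotropic_subspace: "isotropic B u \<Longrightarrow> vec.subspace u"
  by (auto simp: isotropic_def)

lemma orthogonal_basis_imp:
  assumes "x \<subseteq> vec.span A" "\<forall>a\<in>A. B a v = 0" "w \<in> x" shows "B w v = 0"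
proof -
  have "A \<subseteq> {u. B v u = 0}" using assms(2) skew[of _ v] by auto
  then have "vec.span A \<subseteq> {u. B v u = 0}" by (rule vec.span_minimal[OF _ subspace_perp])
  then show ?thesis using assms skew[of w v] by auto
qed

text \<open>Extend a basis of \<open>x\<close> to the whole space. A vector of \<open>x\<close>
  orthogonal to the \<open>2 * n - dim x\<close> added vectors is orthogonal to everything and hence
  zero, so \<open>dim x\<close> is at most their number.\<close>

lemma isotropic_dim_le:
  assumes "isotropic B x" shows "vec.dim x \<le> n"
proof -
  obtain b where b: "b \<subseteq> x" "vec.independent b" "x \<subseteq> vec.span b" "card b = vec.dim x"
    using vec.basis_exists by blast
  obtain b' where b': "b \<subseteq> b'" "vec.independent b'" "UNIV \<subseteq> vec.span b'"
    using vec.maximal_independent_subset_extend[of b UNIV] b by auto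
  have fin: "finite b'" using b' vec.finiteI_independent by blast
  have "card b' = vec.dim (UNIV :: ('a ^ 'n) set)" using b' by (intro vec.basis_card_eq_dim) auto
  then have cb': "card b' = 2 * n" using dimV by (simp add: card_cart_basis)
  let ?A = "b' - b"
  have cA: "card ?A = 2 * n - vec.dim x"
    using card_Diff_subset[OF finite_subset[OF b'(1) fin] b'(1)] cb' b(4) by simp
  have "x \<inter> {v. \<forall>a\<in>?A. B a v = 0} \<subseteq> {0}"
  proof
    fix v assume v: "v \<in> x \<inter> {v. \<forall>a\<in>?A. B a v = 0}"
    have "\<forall>a\<in>b'. B a v = 0" using v b(1) isotropicD[OF assms] by blast
    then have "B w v = 0" for w using orthogonal_basis_imp[OF b'(3)] by blast
    then have "B v w = 0" for w using skew[of w v] by simp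
    then show "v \<in> {0}" using nondeg by blast
  qed
  then have "vec.dim (x \<inter> {v. \<forall>a\<in>?A. B a v = 0}) = 0" by simp
  moreover have "vec.dim x \<le> vec.dim (x \<inter> {v. \<forall>a\<in>?A. B a v = 0}) + card ?A"
    using fin isotropic_subspace[OF assms] by (intro dim_inter_perp_set) auto
  moreover have "vec.dim x \<le> 2 * n" using dim_subset_UNIV_cart_gen[of x] dimV by simp
  ultimately show ?thesis using cA by linarith
qed

abbreviation "verts \<equiv> dual_polar_verts B"

lemma verts_perp:
  assumes x: "x \<in> verts" and v: "\<And>w. w \<in> x \<Longrightarrow> B w v = 0" shows "v \<in> x"
proof -
  have iso: "isotropic B x" using x by (simp add: dual_polar_verts_def)
  have v': "B v w = 0" if "w \<in> x" for w
    using skew[of v w] v[OF that] by simp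
  have "isotropic B (vec.span (insert v x))"
    by (rule isotropic_span) (use isotropicD[OF iso] v v' in auto)
  moreover have "x \<subseteq> vec.span (insert v x)" using vec.span_superset by blast
  ultimately have "vec.span (insert v x) = x" using x by (simp add: dual_polar_verts_def)
  moreover have "v \<in> vec.span (insert v x)" by (intro vec.span_base) simp
  ultimately show ?thesis by simp
qed

text \<open>A maximal isotropic \<open>x\<close> contains everything orthogonal to it, and that
  subspace has dimension at least \<open>2 * n - dim x\<close>. Together with
  \<open>isotropic_dim_le\<close> this yields dimension \<open>n\<close>.\<close>

lemma verts_iff: "x \<in> verts \<longleftrightarrow> isotropic B x \<and> vec.dim x = n"
proof
  assume x: "x \<in> verts"
  then have iso: "isotropic B x" by (simp add: dual_polar_verts_def)
  obtain b where b: "b \<subseteq> x" "vec.independent b" "x \<subseteq> vec.span b" "card b = vec.dim x"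
    using vec.basis_exists by blast
  have fin: "finite b" using b vec.finiteI_independent by blast
  have "UNIV \<inter> {v. \<forall>a\<in>b. B a v = 0} \<subseteq> x"
    using orthogonal_basis_imp[OF b(3)] by (auto intro: verts_perp[OF x])
  then have "vec.dim (UNIV \<inter> {v. \<forall>a\<in>b. B a v = 0}) \<le> vec.dim x" by (rule vec.dim_subset)
  moreover have "vec.dim (UNIV :: ('a ^ 'n) set) \<le> vec.dim (UNIV \<inter> {v. \<forall>a\<in>b. B a v = 0}) + card b"
    by (rule dim_inter_perp_set[OF fin vec.subspace_UNIV])
  ultimately have "2 * n \<le> 2 * vec.dim x" using b(4) dimV by (simp add: card_cart_basis)
  then show "isotropic B x \<and> vec.dim x = n" using iso isotropic_dim_le[OF iso] by simp
next
  assume x: "isotropic B x \<and> vec.dim x = n"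
  have "x = y" if y: "isotropic B y" "x \<subseteq> y" for y
    by (rule vec_subset_dim_eq) (use x y isotropic_dim_le[OF y(1)] isotropic_subspace in auto)
  then have "\<forall>y. isotropic B y \<and> x \<subseteq> y \<longrightarrow> y = x" by (simp add: eq_commute)
  then show "x \<in> verts" using x by (simp add: dual_polar_verts_def)
qed

lemma verts_subspace: "x \<in> verts \<Longrightarrow> vec.subspace x"
  and verts_dim: "x \<in> verts \<Longrightarrow> vec.dim x = n"
  and verts_orth: "x \<in> verts \<Longrightarrow> u \<in> x \<Longrightarrow> v \<in> x \<Longrightarrow> B u v = 0"
  by (auto simp: verts_iff isotropic_def)

lemma inter_subspace: "x \<in> verts \<Longrightarrow> y \<in> verts \<Longrightarrow> vec.subspace (x \<inter> y)"
  by (intro vec.subspace_inter verts_subspace)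

lemma verts_eq: assumes "x \<in> verts" "y \<in> verts" "n \<le> vec.dim (x \<inter> y)" shows "x = y"
proof -
  have "x \<inter> y = x"
    by (rule vec_subset_dim_eq) (use assms inter_subspace verts_subspace verts_dim in auto)
  moreover have "x \<inter> y = y"
    by (rule vec_subset_dim_eq) (use assms inter_subspace verts_subspace verts_dim in auto)
  ultimately show ?thesis by blast
qed

lemma dim_inter_le: "x \<in> verts \<Longrightarrow> vec.dim (x \<inter> y) \<le> n"
  using verts_dim vec.dim_subset[of "x \<inter> y" x] by simp

lemma dim_hyperplane_inter:
  assumes "vec.subspace S" "vec.subspace T" "S \<subseteq> y" "T \<subseteq> y" "vec.subspace y"
  shows "vec.dim S + vec.dim T \<le> vec.dim (S \<inter> T) + vec.dim y"
proof -
  have "{s + t | s t. s \<in> S \<and> t \<in> T} \<subseteq> y" using assms by (auto intro: vec.subspace_add)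
  then have "vec.dim {s + t | s t. s \<in> S \<and> t \<in> T} \<le> vec.dim y" by (rule vec.dim_subset)
  then show ?thesis using vec.dim_sums_Int[OF assms(1,2)] by simp
qed

subsection \<open>The dual polar graph\<close>

text \<open>The distance of the dual polar graph, expressed by codimension instead of paths;
  \<open>J_step\<close> and \<open>J_closer\<close> supply its distance properties. The subtraction
  does not truncate on vertices.\<close>

definition J :: "('a ^ 'n) set \<Rightarrow> ('a ^ 'n) set \<Rightarrow> nat" where
  "J x y = n - vec.dim (x \<inter> y)"

definition sadj (infix "\<sim>" 50) where "x \<sim> y \<longleftrightarrow> x \<in> verts \<and> y \<in> verts \<and> J x y = 1"

lemma dual_polar_adj_iff: assumes "n \<ge> 1" "d = Suc n" shows "dual_polar_adj d B x y \<longleftrightarrow> x \<sim> y"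
  using assms dim_inter_le[of x y] by (auto simp: dual_polar_adj_def sadj_def J_def)

lemma J_sym: "J x y = J y x" by (simp add: J_def Int_commute)

lemma sadj_sym: "x \<sim> y \<Longrightarrow> y \<sim> x" by (auto simp: sadj_def J_sym)

lemma J_0: "x \<in> verts \<Longrightarrow> y \<in> verts \<Longrightarrow> J x y = 0 \<longleftrightarrow> x = y"
  using verts_eq[of x y] verts_dim[of x] by (auto simp: J_def)

lemma dim_inter: "x \<in> verts \<Longrightarrow> vec.dim (x \<inter> y) + J x y = n"
  using dim_inter_le[of x y] by (simp add: J_def)

lemma J_step: assumes x: "x \<in> verts" and yz: "y \<sim> z" shows "J x z \<le> J x y + 1"
proof -
  have y: "y \<in> verts" and z: "z \<in> verts" and J1: "J y z = 1" using yz by (auto simp: sadj_def)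
  have "vec.dim (x \<inter> y) + vec.dim (y \<inter> z) \<le> vec.dim ((x \<inter> y) \<inter> (y \<inter> z)) + vec.dim y"
    using inter_subspace verts_subspace x y z by (intro dim_hyperplane_inter) auto
  moreover have "vec.dim ((x \<inter> y) \<inter> (y \<inter> z)) \<le> vec.dim (x \<inter> z)" by (intro vec.dim_subset) auto
  ultimately show ?thesis
    using dim_inter[OF x, of y] dim_inter[OF x, of z] dim_inter[OF y, of z] J1 verts_dim[OF y] by linarith
qed

text \<open>Take \<open>a\<close> in \<open>y\<close> outside \<open>x\<close> and let
  \<open>z\<close> be spanned by \<open>a\<close> and the part \<open>h\<close> of \<open>x\<close>
  orthogonal to \<open>a\<close>. Then \<open>z\<close> contains both \<open>a\<close> and
  \<open>x \<inter> y\<close>, so it meets \<open>y\<close> in a larger subspace.\<close>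

lemma J_closer:
  assumes x: "x \<in> verts" and y: "y \<in> verts" and pos: "J x y > 0"
  obtains z where "x \<sim> z" "J z y + 1 = J x y"
proof -
  have "\<not> y \<subseteq> x"
  proof
    assume "y \<subseteq> x"
    then have "x \<inter> y = y" by blast
    then show False using pos verts_dim[OF y] by (simp add: J_def)
  qed
  then obtain a where a: "a \<in> y" "a \<notin> x" by blast
  define h where "h = x \<inter> {v. B a v = 0}"
  have hs: "vec.subspace h"
    unfolding h_def by (intro vec.subspace_inter verts_subspace x subspace_perp)
  have dh: "n \<le> vec.dim h + 1"
    using dim_inter_perp[OF verts_subspace[OF x], of a] verts_dim[OF x] by (simp add: h_def)
  have hx: "h \<subseteq> x" and ha: "\<And>v. v \<in> h \<Longrightarrow> B a v = 0" by (auto simp: h_def)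
  have aspan: "a \<notin> vec.span h" using a hs hx by (intro notin_span_subspace) auto
  define z where "z = vec.span (insert a h)"
  have iso: "isotropic B z" unfolding z_def
  proof (rule isotropic_span)
    fix u v assume "u \<in> insert a h" "v \<in> insert a h"
    then consider "u = a" "v = a" | "u = a" "v \<in> h" | "u \<in> h" "v = a" | "u \<in> x" "v \<in> x"
      using hx by blast
    then show "B u v = 0"
    proof cases
      case 1
      then show ?thesis by simp
    next
      case 2
      then show ?thesis using ha by simp
    next
      case 3
      then show ?thesis using skew[of u a] ha by simp
    next
      case 4
      then show ?thesis by (rule verts_orth[OF x])
    qed
  qed
  have "vec.dim z = vec.dim h + 1" unfolding z_def vec.dim_span by (simp add: vec.dim_insert aspan)
  then have "vec.dim z = n" using isotropic_dim_le[OF iso] dh by linarith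
  then have zv: "z \<in> verts" using iso verts_iff by blast
  have h_z: "h \<subseteq> z" unfolding z_def by (meson subset_insertI order_trans vec.span_superset)
  have a_z: "a \<in> z" unfolding z_def by (intro vec.span_base) simp
  have "x \<noteq> z" using a(2) a_z by blast
  then have "J x z > 0" using J_0[OF x zv] by simp
  moreover have "vec.dim h \<le> vec.dim (x \<inter> z)" using h_z hx by (intro vec.dim_subset) auto
  then have "J x z \<le> 1" using dh by (simp add: J_def)
  ultimately have adj: "x \<sim> z" using x zv by (simp add: sadj_def)
  have "x \<inter> y \<subseteq> h" using a(1) verts_orth[OF y] by (auto simp: h_def)
  then have "x \<inter> y \<subseteq> z" using h_z by blast
  then have "insert a (x \<inter> y) \<subseteq> z \<inter> y" using a a_z by blast
  then have "vec.dim (insert a (x \<inter> y)) \<le> vec.dim (z \<inter> y)" by (rule vec.dim_subset)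
  moreover have "a \<notin> vec.span (x \<inter> y)"
    using a inter_subspace[OF x y] by (intro notin_span_subspace) auto
  ultimately have "vec.dim (x \<inter> y) + 1 \<le> vec.dim (z \<inter> y)" by (simp add: vec.dim_insert)
  then have "J z y + 1 \<le> J x y" using dim_inter[OF x, of y] dim_inter[OF zv, of y] by linarith
  moreover have "J x y \<le> J z y + 1" using J_step[OF y sadj_sym[OF adj]] J_sym by simp
  ultimately have "J z y + 1 = J x y" by linarith
  then show ?thesis using that adj by blast
qed

lemma sadjI:
  assumes x: "x \<in> verts" and y: "y \<in> verts" and "x \<noteq> y" and S: "S \<subseteq> x \<inter> y" "n \<le> vec.dim S + 1"
  shows "x \<sim> y"
proof -
  have "vec.dim S \<le> vec.dim (x \<inter> y)" by (rule vec.dim_subset[OF S(1)])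
  then have "J x y \<le> 1" using S(2) by (simp add: J_def)
  moreover have "J x y \<noteq> 0" using J_0 assms by simp
  ultimately show ?thesis using x y by (simp add: sadj_def)
qed

text \<open>If some \<open>a\<close> in \<open>x \<inter> y\<close> were missing from
  \<open>z\<close>, then by dimensions \<open>z \<inter> y\<close> would contain a \<open>b\<close>
  outside \<open>x\<close>. Then \<open>z\<close> is spanned by \<open>x \<inter> z\<close> and
  \<open>b\<close>, all orthogonal to \<open>a\<close>, and maximality of \<open>z\<close> forces
  \<open>a\<close> into it.\<close>

lemma inter_subset_nbr:
  assumes xz: "x \<sim> z" and y: "y \<in> verts" and J: "J z y \<le> J x y"
  shows "x \<inter> y \<subseteq> z"
proof
  have x: "x \<in> verts" and z: "z \<in> verts" and J1: "J x z = 1" using xz by (auto simp: sadj_def)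
  fix a assume a: "a \<in> x \<inter> y"
  show "a \<in> z"
  proof (rule ccontr)
    assume anz: "a \<notin> z"
    let ?h = "x \<inter> z"
    have sh: "vec.subspace (?h \<inter> y)" using inter_subspace[OF x z] verts_subspace[OF y] by (rule vec.subspace_inter)
    have "a \<notin> vec.span (?h \<inter> y)" using anz sh by (intro notin_span_subspace) auto
    then have "vec.dim (insert a (?h \<inter> y)) = vec.dim (?h \<inter> y) + 1" by (simp add: vec.dim_insert)
    moreover have "vec.dim (insert a (?h \<inter> y)) \<le> vec.dim (x \<inter> y)" using a by (intro vec.dim_subset) auto
    ultimately have "vec.dim (?h \<inter> y) < vec.dim (z \<inter> y)"
      using J dim_inter[OF x, of y] dim_inter[OF z, of y] by linarith
    then have "\<not> z \<inter> y \<subseteq> ?h \<inter> y" using vec.dim_subset[of "z \<inter> y" "?h \<inter> y"] by linarith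
    then obtain b where b: "b \<in> z" "b \<in> y" "b \<notin> x" by blast
    have bh: "b \<notin> vec.span ?h" using b inter_subspace[OF x z] by (intro notin_span_subspace) auto
    have "vec.span (insert b ?h) = z"
    proof (rule vec_subset_dim_eq)
      show "vec.span (insert b ?h) \<subseteq> z" using b verts_subspace[OF z] by (intro vec.span_minimal) auto
      show "vec.dim z \<le> vec.dim (vec.span (insert b ?h))"
        using bh verts_dim[OF z] dim_inter[OF x, of z] J1 by (simp add: vec.dim_insert)
    qed (use verts_subspace[OF z] in auto)
    moreover have "\<forall>c\<in>insert b ?h. B c a = 0"
      using verts_orth[OF x] verts_orth[OF y] a b by auto
    ultimately have "\<And>w. w \<in> z \<Longrightarrow> B w a = 0" using orthogonal_basis_imp[of z "insert b ?h" a] by blast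
    then show False using verts_perp[OF z] anz by blast
  qed
qed

end

section \<open>Antiregularity of quads in odd characteristic\<close>

context symplectic
begin

text \<open>Since \<open>J x x' = 2\<close>, the two hyperplanes \<open>x \<inter> y\<close> and
  \<open>x' \<inter> y\<close> of \<open>y\<close> are distinct, so they span
  \<open>y\<close>.\<close>

lemma sum_of_hyperplanes:
  assumes xy: "x \<sim> y" and x'y: "x' \<sim> y" and J2: "J x x' = 2" and v: "v \<in> y"
  obtains s t where "s \<in> x \<inter> y" "t \<in> x' \<inter> y" "v = s + t"
proof -
  have x: "x \<in> verts" and y: "y \<in> verts" and x': "x' \<in> verts" and J1: "J x y = 1" "J x' y = 1"
    using xy x'y by (auto simp: sadj_def)
  let ?S = "{s + t | s t. s \<in> x \<inter> y \<and> t \<in> x' \<inter> y}"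
  have sub: "vec.subspace (x \<inter> y)" "vec.subspace (x' \<inter> y)" using inter_subspace x x' y by auto
  have "vec.dim ((x \<inter> y) \<inter> (x' \<inter> y)) \<le> vec.dim (x \<inter> x')" by (intro vec.dim_subset) auto
  then have "n \<le> vec.dim ?S"
    using vec.dim_sums_Int[OF sub] dim_inter[OF x, of y] dim_inter[OF x', of y] dim_inter[OF x, of x'] J1 J2
    by linarith
  moreover have "?S \<subseteq> y" using verts_subspace[OF y] by (auto intro: vec.subspace_add)
  ultimately have "?S = y"
    using verts_subspace[OF y] verts_dim[OF y] vec.subspace_sums[OF sub] by (intro vec_subset_dim_eq) auto
  then show ?thesis using v that by blast
qed

text \<open>
  Modulo \<open>y \<inter> z\<close> this takes place in a 4-dimensional symplectic space: for \<open>q\<close> odd, its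
  isotropic lines form an antiregular generalized quadrangle. If \<open>x = \<langle>a\<^sub>1, b\<^sub>1\<rangle>\<close>,
  \<open>x\<^sub>1 = \<langle>a\<^sub>2, b\<^sub>2\<rangle>\<close>, \<open>x\<^sub>2 = \<langle>a\<^sub>1 + a\<^sub>2, b\<^sub>1 + b\<^sub>2\<rangle>\<close>, then \<open>t\<close> and \<open>t'\<close> are the
  lines through \<open>a\<^sub>1 + b\<^sub>1\<close> meeting \<open>x\<^sub>1\<close> and \<open>x\<^sub>2\<close>.
\<close>
lemma antiregularity:
  assumes two: "(2 :: 'a) \<noteq> 0"
    and xy: "x \<sim> y" "x1 \<sim> y" "x2 \<sim> y" and xz: "x \<sim> z" "x1 \<sim> z" "x2 \<sim> z"
    and J2: "J x x1 = 2" "J x x2 = 2" "J x1 x2 = 2" "J y z = 2"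
  obtains t t' where "t \<sim> x" "t \<sim> x1" "t' \<sim> x" "t' \<sim> x2" "t \<sim> t'"
proof -
  have V: "x \<in> verts" "x1 \<in> verts" "x2 \<in> verts" "y \<in> verts" "z \<in> verts"
    using xy xz by (auto simp: sadj_def)
  define K where "K = y \<inter> z"
  have sK: "vec.subspace K" unfolding K_def using V by (intro inter_subspace)
  have dK: "vec.dim K + 2 = n" using dim_inter[OF V(4), of z] J2 by (simp add: K_def)
  have "K \<subseteq> v" if "v \<sim> y" "v \<sim> z" for v
    unfolding K_def using inter_subset_nbr[OF sadj_sym[OF that(1)] V(5)] that J2(4)
    by (simp add: sadj_def)
  then have Kx: "K \<subseteq> x" "K \<subseteq> x1" "K \<subseteq> x2" using xy xz by blast+
  have Keq: "u \<inter> v = K" if "u \<in> verts" "v \<in> verts" "K \<subseteq> u" "K \<subseteq> v" "J u v = 2" for u v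
  proof -
    have "K = u \<inter> v"
      using sK inter_subspace[OF that(1,2)] that(3,4)
        dim_inter[OF that(1), of v] that(5) dK by (intro vec_subset_dim_eq) auto
    then show ?thesis by simp
  qed
  have K01: "x \<inter> x1 = K" and K02: "x \<inter> x2 = K" and K12: "x1 \<inter> x2 = K"
    using Keq V Kx J2 by auto
  have ex: "\<exists>v\<in>x2 \<inter> u. v \<notin> K" if "x2 \<sim> u" for u
  proof -
    have "vec.dim (x2 \<inter> u) + 1 = n" using dim_inter[OF V(3), of u] that by (simp add: sadj_def)
    then have "\<not> x2 \<inter> u \<subseteq> K" using vec.dim_subset[of "x2 \<inter> u" K] dK by linarith
    then show ?thesis by blast
  qed
  obtain a3 where a3: "a3 \<in> x2" "a3 \<in> y" "a3 \<notin> K" using ex[OF xy(3)] by blast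
  obtain b3 where b3: "b3 \<in> x2" "b3 \<in> z" "b3 \<notin> K" using ex[OF xz(3)] by blast
  obtain a1 a2 where a: "a1 \<in> x" "a1 \<in> y" "a2 \<in> x1" "a2 \<in> y" "a3 = a1 + a2"
    using sum_of_hyperplanes[OF xy(1,2) J2(1) a3(2)] by blast
  obtain b1 b2 where b: "b1 \<in> x" "b1 \<in> z" "b2 \<in> x1" "b2 \<in> z" "b3 = b1 + b2"
    using sum_of_hyperplanes[OF xz(1,2) J2(1) b3(2)] by blast
  note S = verts_subspace[OF V(1)] verts_subspace[OF V(2)] verts_subspace[OF V(3)]
    verts_subspace[OF V(4)] verts_subspace[OF V(5)]
  have a1K: "a1 \<notin> K" using a a3 Kx K12 S vec.subspace_add[OF S(2), of a1 a2] by blast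
  have b1K: "b1 \<notin> K" using b b3 Kx K12 S vec.subspace_add[OF S(2), of b1 b2] by blast
  have b2K: "b2 \<notin> K" using b b3 Kx K02 S vec.subspace_add[OF S(1), of b1 b2] by blast
  define p where "p = a1 + b1"
  \<comment> \<open>Modulo \<open>K\<close>, \<open>r\<close> and \<open>s\<close> are the points of
    \<open>x1\<close> and \<open>x2\<close> orthogonal to \<open>p\<close>; the orthogonality comes
    down to \<open>B a3 b3 = 0\<close>, expanded in \<open>key\<close>.\<close>
  define r where "r = a2 - b2"
  define s where "s = a3 - b3"
  have px: "p \<in> x" and rx: "r \<in> x1" and sx: "s \<in> x2"
    unfolding p_def r_def s_def using a b a3 b3 S by (auto intro: vec.subspace_add vec.subspace_diff)
  have Ky: "K \<subseteq> y" by (simp add: K_def)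
  have pK: "p \<notin> K"
  proof
    assume "p \<in> K"
    then have "p - a1 \<in> y" using Ky a S(4) by (intro vec.subspace_diff) auto
    then show False using b b1K by (simp add: p_def K_def)
  qed
  have rK: "r \<notin> K"
  proof
    assume "r \<in> K"
    then have "a2 - r \<in> y" using Ky a S(4) by (intro vec.subspace_diff) auto
    then show False using b b2K by (simp add: r_def K_def)
  qed
  have sK': "s \<notin> K"
  proof
    assume "s \<in> K"
    then have "a3 - s \<in> y" using Ky a3 S(4) by (intro vec.subspace_diff) auto
    then show False using b3 by (simp add: s_def K_def)
  qed
  have r0: "r \<notin> x" using rx rK K01 by blast
  have s0: "s \<notin> x" using sx sK' K02 by blast
  have p1: "p \<notin> x1" using px pK K01 by blast
  have p2: "p \<notin> x2" using px pK K02 by blast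
  have spK: "vec.span K = K" using sK by (rule vec.span_eq_iff[THEN iffD2])
  have pspan: "vec.span (insert p K) \<subseteq> x" using px Kx S by (intro vec.span_minimal) auto
  have dp: "vec.dim (insert p K) + 1 = n" using notin_span_subspace[OF sK pK] dK by (simp add: vec.dim_insert)
  have dr: "vec.dim (insert r K) + 1 = n" using notin_span_subspace[OF sK rK] dK by (simp add: vec.dim_insert)
  have dss: "vec.dim (insert s K) + 1 = n" using notin_span_subspace[OF sK sK'] dK by (simp add: vec.dim_insert)
  have "B a3 b3 = 0" using a3 b3 verts_orth[OF V(3)] by blast
  moreover have zero: "B a1 b1 = 0" "B a2 b2 = 0" "B a1 a2 = 0" "B b1 b2 = 0"
    using a b verts_orth V by blast+
  ultimately have key: "B a1 b2 + B a2 b1 = 0" using a b by (simp add: addL addR add.commute)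
  have "B p r = - (B a1 b2 + B a2 b1)"
    using zero skew[of b1 a2] by (simp add: p_def r_def addL diffR)
  then have pr: "B p r = 0" using key by simp
  have ps: "B p s = 0"
  proof -
    have s: "s = r + (a1 - b1)" using a b by (simp add: s_def r_def)
    have "B p (a1 - b1) = 0" using zero skew[of b1 a1] by (simp add: p_def addL diffR)
    then show ?thesis using pr by (simp add: s addR)
  qed
  have vert: "vec.span (insert v (insert p K)) \<in> verts"
    if v: "v \<notin> x" "B p v = 0" and vK: "\<And>k. k \<in> K \<Longrightarrow> B v k = 0" for v
  proof -
    have "isotropic B (vec.span (insert v (insert p K)))"
    proof (rule isotropic_span)
      fix i j assume "i \<in> insert v (insert p K)" "j \<in> insert v (insert p K)"
      then consider "i = v" "j = v" | "i = v" "j = p" | "i = v" "j \<in> K" | "i = p" "j = v"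
        | "i \<in> K" "j = v" | "i \<in> insert p K" "j \<in> insert p K" by blast
      then show "B i j = 0"
      proof cases
        case 6
        then show ?thesis using px Kx verts_orth[OF V(1)] by blast
      qed (use v vK skew[of v p] skew[of i v] in auto)
    qed
    moreover have "v \<notin> vec.span (insert p K)" using v pspan by blast
    then have "vec.dim (vec.span (insert v (insert p K))) = n"
      using dp vec.dim_insert[of v "insert p K"] by simp
    ultimately show ?thesis by (simp add: verts_iff)
  qed
  define t where "t = vec.span (insert r (insert p K))"
  define t' where "t' = vec.span (insert s (insert p K))"
  have tV: "t \<in> verts" unfolding t_def using r0 pr rx Kx verts_orth[OF V(2)] by (intro vert) auto
  have tV': "t' \<in> verts" unfolding t'_def using s0 ps sx Kx verts_orth[OF V(3)] by (intro vert) auto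
  have pt: "insert p K \<subseteq> t" "insert r K \<subseteq> t" "insert p K \<subseteq> t'" "insert s K \<subseteq> t'"
    unfolding t_def t'_def by (auto intro: vec.span_base)
  have tx: "t \<sim> x" using pt r0 px Kx dp by (intro sadjI[OF tV V(1), where S = "insert p K"]) auto
  moreover have "t \<sim> x1" using pt p1 rx Kx dr by (intro sadjI[OF tV V(2), where S = "insert r K"]) auto
  moreover have "t' \<sim> x" using pt s0 px Kx dp by (intro sadjI[OF tV' V(1), where S = "insert p K"]) auto
  moreover have "t' \<sim> x2" using pt p2 sx Kx dss by (intro sadjI[OF tV' V(3), where S = "insert s K"]) auto
  \<comment> \<open>This is where odd characteristic enters: if \<open>t = t'\<close>, then
    \<open>p + (s - r) = 2 *s a1\<close> puts \<open>a1\<close> into \<open>t \<inter> x\<close>,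
    spanned by \<open>p\<close> and \<open>K\<close>. Comparing the \<open>b1\<close> parts modulo
    \<open>y\<close> then forces \<open>a1\<close> into \<open>K\<close>.\<close>
  moreover have "t \<noteq> t'"
  proof
    assume "t = t'"
    then have "s - r \<in> t" using pt verts_subspace[OF tV] by (intro vec.subspace_diff) auto
    then have "p + (s - r) \<in> t" using pt verts_subspace[OF tV] by (intro vec.subspace_add) auto
    then have "(1 / 2) *s (p + (s - r)) \<in> t" by (intro vec.subspace_scale verts_subspace[OF tV])
    moreover have "p + (s - r) = 2 *s a1"
    proof -
      have "2 *s a1 = a1 + a1" using vector_sadd_rdistrib[of 1 1 a1] by simp
      then show ?thesis using a b by (simp add: p_def s_def r_def)
    qed
    ultimately have "a1 \<in> t" using two by simp
    moreover have "vec.span (insert p K) = t \<inter> x"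
    proof (rule vec_subset_dim_eq)
      show "vec.span (insert p K) \<subseteq> t \<inter> x"
        using pspan vec.span_minimal[OF pt(1) verts_subspace[OF tV]] by blast
      show "vec.dim (t \<inter> x) \<le> vec.dim (vec.span (insert p K))"
        using dim_inter[OF tV, of x] tx dp by (simp add: sadj_def)
    qed (use inter_subspace[OF tV V(1)] in auto)
    ultimately have "a1 \<in> vec.span (insert p K)" using a by blast
    then obtain k where k: "a1 - k *s p \<in> K" unfolding vec.span_breakdown_eq spK by blast
    then have "a1 - k *s p \<in> y" using Ky by blast
    then have "a1 - (a1 - k *s p) \<in> y" by (rule vec.subspace_diff[OF S(4) a(2)])
    then have "a1 - (a1 - k *s p) - k *s a1 \<in> y"
      by (rule vec.subspace_diff[OF S(4) _ vec.subspace_scale[OF S(4) a(2)]])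
    then have kb: "k *s b1 \<in> y" by (simp add: p_def vec.scale_right_distrib)
    have "k = 0"
    proof (rule ccontr)
      assume "k \<noteq> 0"
      then have "b1 \<in> y" using vec.subspace_scale[OF S(4) kb, of "1 / k"] by simp
      then show False using b b1K by (simp add: K_def)
    qed
    then show False using k a1K by simp
  qed
  then have "t \<sim> t'" using pt dp by (intro sadjI[OF tV tV', where S = "insert p K"]) auto
  ultimately show ?thesis using that by blast
qed

end

section \<open>The Hemmeter graph\<close>

locale hemmeter = symplectic B n for B :: "'a::field ^ 'n \<Rightarrow> 'a ^ 'n \<Rightarrow> 'a" and n +
  fixes d :: nat
  assumes n_pos: "n \<ge> 1" and d_Suc: "d = Suc n"
begin

lemma hem_verts_iff [simp]: "(x, s) \<in> hem_verts B \<longleftrightarrow> x \<in> verts"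
  by (simp add: hem_verts_def)

lemma hem_adj_iff:
  "hem_adj d B (x, s) (y, t) \<longleftrightarrow> x \<in> verts \<and> y \<in> verts \<and> s \<noteq> t \<and> (x = y \<or> x \<sim> y)"
  using dual_polar_adj_iff[OF n_pos d_Suc] by (simp add: hem_adj_def)

text \<open>Each edge changes the sign, so the parity of a path length is fixed by the signs of its
  ends. If the parity of \<open>J x y\<close> is wrong, one extra edge between the two copies of the
  same subspace is needed.\<close>

fun hem_dist :: "('a ^ 'n) set \<times> bool \<Rightarrow> ('a ^ 'n) set \<times> bool \<Rightarrow> nat" where
  "hem_dist (x, s) (y, t) = (if even (J x y) \<longleftrightarrow> s = t then J x y else J x y + 1)"

lemma hem_dist_0:
  assumes "x \<in> verts" "y \<in> verts" shows "hem_dist (x, s) (y, t) = 0 \<longleftrightarrow> x = y \<and> s = t"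
  using J_0[OF assms] by auto

lemma hem_dist_step:
  assumes x: "x \<in> verts" and adj: "hem_adj d B (y, t) (z, r)"
  shows "hem_dist (x, s) (z, r) \<le> hem_dist (x, s) (y, t) + 1"
proof (cases "y = z")
  case True
  then show ?thesis using adj by (auto simp: hem_adj_iff)
next
  case False
  then have yz: "y \<sim> z" and tr: "t \<noteq> r" using adj by (auto simp: hem_adj_iff)
  have "J x z \<le> J x y + 1" "J x y \<le> J x z + 1" using J_step[OF x yz] J_step[OF x sadj_sym[OF yz]] by auto
  then consider "J x z = J x y" | "J x z = Suc (J x y)" | "J x y = Suc (J x z)" by linarith
  then show ?thesis using tr by cases auto
qed

lemma hem_dist_closer:
  assumes x: "x \<in> verts" and y: "y \<in> verts" and pos: "hem_dist (x, s) (y, t) > 0"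
  shows "\<exists>z r. hem_adj d B (y, t) (z, r) \<and> hem_dist (x, s) (z, r) + 1 = hem_dist (x, s) (y, t)"
proof (cases "even (J x y) \<longleftrightarrow> s = t")
  case True
  then have "J y x > 0" using pos J_sym[of x y] by simp
  then obtain z where z: "y \<sim> z" "J z x + 1 = J y x" using J_closer[OF y x] by blast
  then have "J x y = Suc (J x z)" using J_sym[of x y] J_sym[of x z] by simp
  then have "hem_dist (x, s) (z, \<not> t) + 1 = hem_dist (x, s) (y, t)" using True by auto
  moreover have "hem_adj d B (y, t) (z, \<not> t)" using z by (simp add: hem_adj_iff sadj_def)
  ultimately show ?thesis by blast
next
  case False
  then have "hem_dist (x, s) (y, \<not> t) + 1 = hem_dist (x, s) (y, t)" by auto
  moreover have "hem_adj d B (y, t) (y, \<not> t)" using y by (simp add: hem_adj_iff)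
  ultimately show ?thesis by blast
qed

lemma graph_dist_hem:
  assumes "drg (hem_verts B) (hem_adj d B) b c" "x \<in> verts" "y \<in> verts"
  shows "graph_dist (hem_adj d B) (x, s) (y, t) = (if even (J x y) \<longleftrightarrow> s = t then J x y else J x y + 1)"
proof -
  have "graph_dist (hem_adj d B) (x, s) (y, t) = hem_dist (x, s) (y, t)"
  proof (rule drg.dist_eqI[OF assms(1)])
    show "hem_dist p r = 0 \<longleftrightarrow> p = r" if "p \<in> hem_verts B" "r \<in> hem_verts B" for p r
      using that hem_dist_0[of "fst p" "fst r" "snd p" "snd r"] by (cases p; cases r) auto
    show "hem_dist p r' \<le> hem_dist p r + 1" if "p \<in> hem_verts B" "hem_adj d B r r'" for p r r'
      using that hem_dist_step by (cases p; cases r; cases r') (simp only: hem_verts_iff)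
    show "\<exists>r'. hem_adj d B r r' \<and> hem_dist p r' + 1 = hem_dist p r"
      if "p \<in> hem_verts B" "r \<in> hem_verts B" "hem_dist p r > 0" for p r
      using that hem_dist_closer by (cases p; cases r) (metis hem_verts_iff)
  qed (use assms in auto)
  then show ?thesis by simp
qed

end

section \<open>Descendents of Hemmeter graphs: signs and width one\<close>

lemma ex_avoid_two: assumes "2 < card S" obtains v where "v \<in> S" "v \<noteq> x" "v \<noteq> y"
proof -
  have "\<not> S \<subseteq> {x, y}"
  proof
    assume "S \<subseteq> {x, y}"
    then have "card S \<le> card {x, y}" by (intro card_mono) auto
    also have "\<dots> \<le> 2" by (simp add: card_insert_if)
    finally show False using assms by simp
  qed
  then show ?thesis using that by blast
qed

locale hemmeter_descendent =
  hemmeter B n d + classical01_descendent "hem_verts B" "hem_adj d B" b c E \<theta> d q \<xi> \<zeta> Y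
  for B :: "'a::field ^ 'n \<Rightarrow> 'a ^ 'n \<Rightarrow> 'a" and n d b c E \<theta> q \<xi> \<zeta> Y +
  assumes two: "(2 :: 'a) \<noteq> 0" and q3: "q \<ge> 3"
begin

lemma dist_hem:
  "x \<in> verts \<Longrightarrow> y \<in> verts \<Longrightarrow> ds (x, s) (y, t) = (if even (J x y) \<longleftrightarrow> s = t then J x y else J x y + 1)"
  by (rule graph_dist_hem[OF drg_axioms])

lemma Y_verts: "(x, s) \<in> Y \<Longrightarrow> x \<in> verts"
  using Y_V by auto

text \<open>Two vertices of equal sign with a common neighbour are at distance two, so
  \<open>m\<close> lies on a geodesic between them.\<close>

lemma between:
  assumes "(x, s) \<in> Y" "(z, s) \<in> Y" "x \<noteq> z" "hem_adj d B (z, s) m" "hem_adj d B m (x, s)"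
  shows "m \<in> Y"
proof -
  have V: "x \<in> verts" "z \<in> verts" using assms Y_verts by auto
  have X: "(x, s) \<in> hem_verts B" using V by simp
  have 1: "ds (x, s) m = 1" using dist_1[OF X] adj_in adj_sym assms(5) by blast
  then have "ds (x, s) (z, s) \<le> 2" using dist_step[OF X adj_sym[OF assms(4)]] by simp
  moreover have "ds (x, s) (z, s) \<noteq> 0" using dist_0 assms(3) V by simp
  moreover have "even (ds (x, s) (z, s))" using dist_hem[OF V, of s s] by simp
  ultimately have "ds (x, s) (z, s) = 2" by (metis dvd_imp_le even_numeral le_antisym not_gr_zero)
  then show ?thesis using convex[OF assms(1,2,4)] 1 by simp
qed

text \<open>There are \<open>c 2 = 1 + q > 2\<close> common neighbours in the graph, all in
  \<open>Y\<close> by convexity, so two prescribed vertices can be avoided.\<close>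

lemma common_nbrs:
  assumes r: "r \<in> Y" and p: "p \<in> Y" and D2: "ds r p = 2"
  obtains m where "m \<in> Y" "hem_adj d B r m" "hem_adj d B p m" "m \<noteq> u" "m \<noteq> v"
proof -
  have V: "r \<in> hem_verts B" "p \<in> hem_verts B" using r p Y_in by auto
  let ?S = "{z\<in>hem_verts B. hem_adj d B p z \<and> ds r z + 1 = ds r p}"
  have "real (c 2) = qint q 2" using c[of 2] dist_le_d[OF V] D2 by simp
  also have "\<dots> > 2" using q3 by (simp add: qint_def numeral_2_eq_2)
  finally have "2 < card ?S" using card_down[OF V] D2 by simp
  then obtain m where m: "m \<in> ?S" "m \<noteq> u" "m \<noteq> v" by (rule ex_avoid_two)
  have "m \<in> Y" using convex[OF r p] m(1) by blast
  moreover have "hem_adj d B r m" using dist_1[OF V(1), of m] m(1) D2 by simp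
  ultimately show ?thesis using that m by blast
qed

text \<open>
  If \<open>x\<^sup>- \<notin> Y\<close>, convexity forces the members of \<open>Y\<close> near \<open>x\<^sup>+\<close> to be pairwise non-adjacent in
  \<open>\<Sigma>\<close>, which \<open>antiregularity\<close> makes impossible.
\<close>
lemma flip_sign:
  assumes x: "(x, s) \<in> Y" and w2: "2 \<le> w"
  shows "(x, \<not> s) \<in> Y"
proof (rule ccontr)
  assume neg: "(x, \<not> s) \<notin> Y"
  have xv: "x \<in> verts" using x Y_verts by blast
  \<comment> \<open>If \<open>x \<sim> v\<close>, the missing vertex \<open>(x, \<not> s)\<close>
    would be a common neighbour of two members of \<open>Y\<close> with sign
    \<open>s\<close>.\<close>
  have nadj: "\<not> x \<sim> v" if v: "(v, s) \<in> Y" for v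
  proof
    assume xv': "x \<sim> v"
    then have "x \<noteq> v" using J_0[OF xv xv] by (auto simp: sadj_def)
    then have "(x, \<not> s) \<in> Y"
      using between[OF x v, of "(x, \<not> s)"] sadj_sym[OF xv'] Y_verts[OF v] xv
      by (auto simp: hem_adj_iff)
    then show False using neg by blast
  qed
  \<comment> \<open>Adjacent \<open>v\<close>, \<open>v'\<close> would bring \<open>(v, s)\<close>
    into \<open>Y\<close>, against \<open>nadj\<close>.\<close>
  have nadj2: "\<not> v \<sim> v'" if v: "(v, \<not> s) \<in> Y" "(v', \<not> s) \<in> Y" "x \<sim> v" for v v'
  proof
    assume a: "v \<sim> v'"
    have V: "v \<in> verts" "v' \<in> verts" using v Y_verts by auto
    have "v \<noteq> v'" using a J_0[OF V] by (auto simp: sadj_def)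
    then have "(v, s) \<in> Y"
      using between[OF v(1,2), of "(v, s)"] sadj_sym[OF a] V by (auto simp: hem_adj_iff)
    then show False using nadj v(3) by blast
  qed
  obtain r1 where r1: "r1 \<in> Y" "hem_adj d B (x, s) r1" "ds (x, s) r1 = 1"
    using up_nbr[OF x x] w2 by auto
  have "ds (x, s) r1 < w" using r1(3) w2 by simp
  then obtain r2 where r2: "r2 \<in> Y" "hem_adj d B r1 r2" "ds (x, s) r2 = ds (x, s) r1 + 1"
    by (rule up_nbr[OF x r1(1)])
  obtain x1 where x1: "(x1, s) \<in> Y" "ds (x, s) (x1, s) = 2"
    using r1(2,3) r2 by (cases r1; cases r2) (auto simp: hem_adj_iff)
  have x1v: "x1 \<in> verts" using x1 Y_verts by blast
  have "J x x1 = 2 \<or> J x x1 = 1" using x1(2) dist_hem[OF xv x1v, of s s] by (auto split: if_splits)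
  moreover have "J x x1 \<noteq> 1" using nadj[OF x1(1)] xv x1v by (simp add: sadj_def)
  ultimately have J01: "J x x1 = 2" by blast
  have nbr: "x \<sim> v \<and> x1 \<sim> v" if "(v, t) \<in> Y" "hem_adj d B (x, s) (v, t)" "hem_adj d B (x1, s) (v, t)" for v t
    using that neg J01 by (auto simp: hem_adj_iff sadj_def J_sym)
  obtain y t where yt: "(y, t) \<in> Y" "hem_adj d B (x, s) (y, t)" "hem_adj d B (x1, s) (y, t)"
    using common_nbrs[OF x x1(1,2)] by (metis surj_pair)
  obtain z t' where zt: "(z, t') \<in> Y" "hem_adj d B (x, s) (z, t')" "hem_adj d B (x1, s) (z, t')" "(z, t') \<noteq> (y, t)"
    using common_nbrs[OF x x1(1,2), of "(y, t)"] by (metis surj_pair)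
  have tt: "t = (\<not> s)" "t' = (\<not> s)" using yt zt by (auto simp: hem_adj_iff)
  have y: "(y, \<not> s) \<in> Y" "x \<sim> y" "x1 \<sim> y" and z: "(z, \<not> s) \<in> Y" "x \<sim> z" "x1 \<sim> z"
    using nbr[OF yt(1-3)] nbr[OF zt(1-3)] yt zt tt by auto
  have yz: "y \<noteq> z" using zt(4) tt by auto
  have V: "y \<in> verts" "z \<in> verts" using y z Y_verts by auto
  have Jyz: "J y z = 2"
  proof -
    have "J y z \<le> J y x + 1" by (rule J_step[OF V(1) z(2)])
    moreover have "J y x = 1" using y(2) by (simp add: sadj_def J_sym)
    moreover have "J y z \<noteq> 0" using J_0[OF V] yz by simp
    moreover have "J y z \<noteq> 1" using nadj2[OF y(1) z(1) y(2)] V by (simp add: sadj_def)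
    ultimately show ?thesis by linarith
  qed
  have "ds (y, \<not> s) (z, \<not> s) = 2" using dist_hem[OF V, of "\<not> s" "\<not> s"] Jyz by simp
  \<comment> \<open>The third common neighbour \<open>x2\<close> of \<open>y\<close> and
    \<open>z\<close>: together with \<open>x\<close> and \<open>x1\<close> it completes the
    configuration needed for \<open>antiregularity\<close>.\<close>
  then obtain m where m: "m \<in> Y" "hem_adj d B (y, \<not> s) m" "hem_adj d B (z, \<not> s) m" "m \<noteq> (x, s)" "m \<noteq> (x1, s)"
    by (rule common_nbrs[OF y(1) z(1)])
  obtain x2 where x2: "m = (x2, s)" using m(2) by (cases m) (auto simp: hem_adj_iff)
  have x2v: "x2 \<in> verts" using m(1) x2 Y_verts by blast
  have "y \<noteq> x2" using m(3) x2 yz nadj2[OF z(1) y(1) z(2)] by (auto simp: hem_adj_iff)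
  moreover have "z \<noteq> x2" using m(2) x2 yz nadj2[OF y(1) z(1) y(2)] by (auto simp: hem_adj_iff)
  ultimately have yx2: "y \<sim> x2" and zx2: "z \<sim> x2" using m(2,3) x2 by (auto simp: hem_adj_iff)
  have two_apart: "J v x2 = 2" if "v \<in> verts" "v \<sim> y" "v \<noteq> x2" "\<not> v \<sim> x2" for v
  proof -
    have "J v x2 \<le> J v y + 1" by (rule J_step[OF that(1) yx2])
    moreover have "J v y = 1" using that(2) by (simp add: sadj_def)
    moreover have "J v x2 \<noteq> 0" using J_0[OF that(1) x2v] that(3) by simp
    moreover have "J v x2 \<noteq> 1" using that(1,4) x2v by (simp add: sadj_def)
    ultimately show ?thesis by linarith
  qed
  have J02: "J x x2 = 2" using two_apart[OF xv y(2)] nadj[of x2] m x2 by blast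
  have "\<not> x1 \<sim> x2"
  proof
    assume a: "x1 \<sim> x2"
    have "(x1, \<not> s) \<in> Y"
      using between[of x1 s x2 "(x1, \<not> s)"] x1(1) m x2 sadj_sym[OF a] x1v x2v by (auto simp: hem_adj_iff)
    then show False using nadj2[OF y(1) _ y(2)] sadj_sym[OF y(3)] by blast
  qed
  then have J12: "J x1 x2 = 2" using two_apart[OF x1v y(3)] m x2 by blast
  \<comment> \<open>These lie between \<open>x\<close> and \<open>x1\<close>, respectively
    \<open>x2\<close>, so both enter \<open>Y\<close> with the opposite sign; their adjacency
    contradicts \<open>nadj2\<close>.\<close>
  obtain l l' where l: "l \<sim> x" "l \<sim> x1" "l' \<sim> x" "l' \<sim> x2" "l \<sim> l'"
    using antiregularity[OF two y(2,3) sadj_sym[OF yx2] z(2,3) sadj_sym[OF zx2] J01 J02 J12 Jyz] by blast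
  have "x \<noteq> x1" "x \<noteq> x2" using J01 J02 J_0[OF xv xv] by auto
  then have "(l, \<not> s) \<in> Y" "(l', \<not> s) \<in> Y"
    using between[OF x x1(1), of "(l, \<not> s)"] between[OF x, of x2 "(l', \<not> s)"] m(1) x2 l
      sadj_sym[OF l(2)] sadj_sym[OF l(4)]
    by (auto simp: hem_adj_iff sadj_def)
  then show False using nadj2[OF _ _ sadj_sym[OF l(1)]] l(5) by blast
qed

text \<open>Distinct members of \<open>Y\<close> are adjacent and hence differ in sign, which leaves
  room for only two.\<close>

lemma width_one_edge:
  assumes w1: "w = 1"
  shows "\<exists>p r. hem_adj d B p r \<and> Y = {p, r}"
proof -
  obtain p where p: "p \<in> Y" using Y_ne by blast
  have "ds p p < w" using w1 by simp
  then obtain r where r: "r \<in> Y" "hem_adj d B p r" by (rule up_nbr[OF p p])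
  have nbr: "v = u \<or> hem_adj d B u v" if "u \<in> Y" "v \<in> Y" for u v
  proof -
    have "ds u v = 0 \<or> ds u v = 1" using dist_le_w[OF that] w1 by linarith
    then show ?thesis using dist_0[OF Y_in[OF that(1)] Y_in[OF that(2)]] dist_1[OF Y_in[OF that(1)] Y_in[OF that(2)]] by auto
  qed
  have "v = r" if v: "v \<in> Y" "v \<noteq> p" for v
  proof -
    have "snd p \<noteq> snd v" "snd p \<noteq> snd r" using nbr[OF p v(1)] v(2) r(2) by (auto simp: hem_adj_def)
    then show ?thesis using nbr[OF r(1) v(1)] by (auto simp: hem_adj_def)
  qed
  then have "Y = {p, r}" using p r by blast
  then show ?thesis using r by blast
qed

section \<open>Descendents of width at least two: reduction to the dual polar graph\<close>

context
  assumes w2: "2 \<le> w"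
begin

definition "Yp = {x. (x, True) \<in> Y}"

lemma in_Y_iff: "(x, s) \<in> Y \<longleftrightarrow> x \<in> Yp"
  using flip_sign[of x True] flip_sign[of x False] w2 by (cases s) (auto simp: Yp_def)

lemma Yp_verts: "x \<in> Yp \<Longrightarrow> x \<in> verts"
  using Y_verts by (auto simp: Yp_def)

text \<open>The sign of \<open>y\<close> is free, so it can be chosen with the wrong parity, which
  makes the distance in the Hemmeter graph \<open>J x y + 1\<close>.\<close>

lemma J_less_w: assumes "x \<in> Yp" "y \<in> Yp" shows "J x y + 1 \<le> w"
proof -
  have "ds (x, True) (y, odd (J x y)) = J x y + 1"
    using dist_hem[of x y] Yp_verts assms by auto
  then show ?thesis using dist_le_w[of "(x, True)" "(y, odd (J x y))"] in_Y_iff assms by simp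
qed

lemma Yp_up:
  assumes x: "x \<in> Yp" and y: "y \<in> Yp" and less: "J x y + 1 < w"
  obtains z where "z \<in> Yp" "y \<sim> z" "J x z = J x y + 1"
proof -
  have V: "x \<in> verts" "y \<in> verts" using x y Yp_verts by auto
  have D: "ds (x, True) (y, odd (J x y)) = J x y + 1" using dist_hem[OF V] by auto
  obtain p where p: "p \<in> Y" "hem_adj d B (y, odd (J x y)) p" "ds (x, True) p = J x y + 2"
    using up_nbr[of "(x, True)" "(y, odd (J x y))"] D less x y in_Y_iff by auto
  obtain z t where zt: "p = (z, t)" by (cases p)
  have z: "z \<in> Yp" using p zt in_Y_iff by simp
  have dz: "ds (x, True) (z, t) \<le> J x z + 1" "ds (x, True) (z, t) \<ge> J x z"
    using dist_hem[OF V(1) Yp_verts[OF z]] by auto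
  have "y \<noteq> z" using dz p(3) zt by auto
  then have yz: "y \<sim> z" using p(2) zt by (auto simp: hem_adj_iff)
  have "J x z = J x y + 1" using J_step[OF V(1) yz] dz p(3) zt by simp
  then show ?thesis using that z yz by blast
qed

text \<open>The signs are chosen so that the distances from \<open>(x, True)\<close> coincide with
  the values of \<open>J\<close>.\<close>

lemma Yp_convex:
  assumes x: "x \<in> Yp" and y: "y \<in> Yp" and yz: "y \<sim> z" and J: "J x z + 1 = J x y"
  shows "z \<in> Yp"
proof -
  have V: "x \<in> verts" "y \<in> verts" "z \<in> verts" using x y Yp_verts yz by (auto simp: sadj_def)
  have e: "even (J x y) \<longleftrightarrow> odd (J x z)" unfolding J[symmetric] by simp
  have "ds (x, True) (y, even (J x y)) = J x y" using dist_hem[OF V(1,2)] by auto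
  moreover have "ds (x, True) (z, odd (J x y)) = J x z" using dist_hem[OF V(1,3)] e by auto
  moreover have "hem_adj d B (y, even (J x y)) (z, odd (J x y))" using V yz by (auto simp: hem_adj_iff)
  ultimately show ?thesis using convex[of "(x, True)" "(y, even (J x y))" "(z, odd (J x y))"] x y J in_Y_iff by simp
qed

text \<open>The sign of \<open>x\<close> is chosen to put it at distance \<open>J y x + 1\<close>
  from \<open>(y, True)\<close>. A copy of \<open>z\<close> is then one step closer even when
  \<open>J y z = J y x\<close>, so neighbours at equal distance in the dual polar graph are captured
  as well.\<close>

lemma Yp_antipodal_convex:
  assumes x: "x \<in> Yp" and y: "y \<in> Yp" and J: "J y x + 1 = w" and xz: "x \<sim> z" and le: "J y z \<le> J y x"
  shows "z \<in> Yp"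
proof -
  have V: "x \<in> verts" "y \<in> verts" "z \<in> verts" using x y Yp_verts xz by (auto simp: sadj_def)
  have "J y x \<le> J y z + 1" using J_step[OF V(2) sadj_sym[OF xz]] .
  then have "J y z = J y x \<or> J y x = Suc (J y z)" using le by linarith
  then have "ds (y, True) (z, even (J y x)) = J y x" using dist_hem[OF V(2,3)] by auto
  moreover have "ds (y, True) (x, odd (J y x)) = J y x + 1" using dist_hem[OF V(2,1)] by auto
  moreover have "hem_adj d B (x, odd (J y x)) (z, even (J y x))" using V xz by (auto simp: hem_adj_iff)
  ultimately show ?thesis using convex[of "(y, True)" "(x, odd (J y x))" "(z, even (J y x))"] x y in_Y_iff by simp
qed

lemma antipode: assumes x: "x \<in> Yp" obtains y where "y \<in> Yp" "J x y + 1 = w"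
proof -
  have "\<exists>y\<in>Yp. J x y = k" if "k < w" for k
    using that
  proof (induction k)
    case 0
    then show ?case using x J_0[of x x] Yp_verts by auto
  next
    case (Suc k)
    then obtain y where "y \<in> Yp" "J x y = k" by auto
    then show ?case using Yp_up[OF x, of y] Suc.prems by auto
  qed
  from this[of "w - 1"] show ?thesis using that w2 by auto
qed

lemma dim_antipodal:
  assumes "x \<in> Yp" "y \<in> Yp" shows "vec.dim (x \<inter> y) + w = d \<longleftrightarrow> J x y + 1 = w"
  using dim_inter[OF Yp_verts[OF assms(1)], of y] d_Suc by auto

text \<open>Once \<open>dim u + w = d\<close>, the witness \<open>y\<close> is an antipode of
  \<open>x\<close> in \<open>Yp\<close>, by \<open>dim_antipodal\<close>.\<close>

definition pole :: "('a ^ 'n) set \<Rightarrow> ('a ^ 'n) set \<Rightarrow> bool" where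
  "pole u x \<longleftrightarrow> x \<in> Yp \<and> (\<exists>y\<in>Yp. x \<inter> y = u)"

lemma antipodal_eq:
  assumes "x \<in> Yp" "y \<in> Yp" "J x y + 1 = w" "vec.subspace u" "vec.dim u + w = d" "u \<subseteq> x \<inter> y"
  shows "x \<inter> y = u"
proof -
  have "u = x \<inter> y"
    using dim_antipodal[OF assms(1,2)] assms inter_subspace[OF Yp_verts Yp_verts, of x y]
    by (intro vec_subset_dim_eq) auto
  then show ?thesis by simp
qed

context
  fixes u :: "('a ^ 'n) set"
  assumes du: "vec.dim u + w = d" and su: "vec.subspace u"
begin

text \<open>Let \<open>y\<close> be the antipode of \<open>x\<close>. No neighbour \<open>z\<close>
  in \<open>Yp\<close> is farther from \<open>y\<close>, so \<open>z\<close> contains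
  \<open>u\<close> by \<open>inter_subset_nbr\<close>. It remains to find an antipode of
  \<open>z\<close> that contains \<open>u\<close>.\<close>

lemma pole_nbr:
  assumes P: "pole u x" and xz: "x \<sim> z" and z: "z \<in> Yp"
  shows "pole u z"
proof -
  obtain y where y: "y \<in> Yp" "x \<inter> y = u" and x: "x \<in> Yp" using P by (auto simp: pole_def)
  have V: "x \<in> verts" "y \<in> verts" "z \<in> verts" using x y z Yp_verts by auto
  have Jxy: "J x y + 1 = w" using dim_antipodal[OF x y(1)] y(2) du by simp
  have Jzy: "J z y + 1 \<le> w" by (rule J_less_w[OF z y(1)])
  have uz: "u \<subseteq> z" using inter_subset_nbr[OF xz V(2)] Jxy Jzy y(2) by simp
  show ?thesis
  proof (cases "J z y + 1 = w")
    case True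
    have "z \<inter> y = u" using uz y by (intro antipodal_eq[OF z y(1) True su du]) auto
    then show ?thesis using z y by (auto simp: pole_def)
  next
    case False
    then have less: "J z y + 1 < w" using Jzy by simp
    \<comment> \<open>Moving \<open>y\<close> one step away from \<open>z\<close> gives an antipode
      of \<open>z\<close>; it cannot be farther from \<open>x\<close> than \<open>y\<close>, so it
      still contains \<open>u\<close>.\<close>
    obtain y' where y': "y' \<in> Yp" "y \<sim> y'" "J z y' = J z y + 1" by (rule Yp_up[OF z y(1) less])
    have "J x y \<le> J z y + 1" using J_step[OF V(2) sadj_sym[OF xz]] J_sym by metis
    then have w: "J z y' + 1 = w" using Jxy y'(3) less by linarith
    have "J y' x \<le> J y x" using J_less_w[OF x y'(1)] Jxy J_sym[of x y] J_sym[of x y'] by simp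
    then have "u \<subseteq> y'" using inter_subset_nbr[OF y'(2) V(1)] y(2) by (simp add: Int_commute)
    then have "z \<inter> y' = u" using uz by (intro antipodal_eq[OF z y'(1) w su du]) auto
    then show ?thesis using z y' by (auto simp: pole_def)
  qed
qed

text \<open>Convexity keeps a geodesic from \<open>x\<close> to \<open>z\<close> inside
  \<open>Yp\<close>, and \<open>pole_nbr\<close> carries \<open>u\<close> along it.\<close>

lemma pole_all: assumes z: "z \<in> Yp" shows "pole u x \<Longrightarrow> pole u z"
proof (induction "J x z" arbitrary: x)
  case 0
  then have "x = z" using J_0[of x z] Yp_verts z by (auto simp: pole_def)
  then show ?case using 0 by simp
next
  case (Suc k)
  have x: "x \<in> Yp" using Suc.prems by (simp add: pole_def)
  then have "J x z > 0" using Suc.hyps(2) by simp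
  then obtain v where v: "x \<sim> v" "J v z + 1 = J x z" by (rule J_closer[OF Yp_verts[OF x] Yp_verts[OF z]])
  have "v \<in> Yp" by (rule Yp_convex[OF z x v(1)]) (use v(2) J_sym in simp)
  then have "pole u v" using pole_nbr[OF Suc.prems v(1)] by blast
  moreover have "k = J v z" using Suc.hyps(2) v(2) by simp
  ultimately show ?case using Suc.hyps(1) by blast
qed

text \<open>The next vertex \<open>v\<close> towards \<open>z\<close> contains
  \<open>x \<inter> z\<close> and so \<open>u\<close>. Hence \<open>v\<close> is no farther than
  \<open>x\<close> from the antipode \<open>y\<close>, and \<open>Yp_antipodal_convex\<close> puts
  it into \<open>Yp\<close>.\<close>

lemma pole_supset: assumes z: "z \<in> verts" "u \<subseteq> z" shows "pole u x \<Longrightarrow> z \<in> Yp"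
proof (induction "J x z" arbitrary: x)
  case 0
  then have "x = z" using J_0[of x z] Yp_verts z by (auto simp: pole_def)
  then show ?case using 0 by (simp add: pole_def)
next
  case (Suc k)
  obtain y where y: "y \<in> Yp" "x \<inter> y = u" and x: "x \<in> Yp" using Suc.prems by (auto simp: pole_def)
  have V: "x \<in> verts" "y \<in> verts" using x y Yp_verts by auto
  have "J x z > 0" using Suc.hyps(2) by simp
  then obtain v where v: "x \<sim> v" "J v z + 1 = J x z" by (rule J_closer[OF V(1) z(1)])
  have vv: "v \<in> verts" using v by (simp add: sadj_def)
  have "x \<inter> z \<subseteq> v" using inter_subset_nbr[OF v(1) z(1)] v(2) by simp
  then have "u \<subseteq> v \<inter> y" using y z by blast
  then have "vec.dim u \<le> vec.dim (v \<inter> y)" by (rule vec.dim_subset)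
  then have "J y v \<le> J y x"
    using dim_inter[OF V(1), of y] dim_inter[OF vv, of y] y(2) J_sym[of y] by simp
  moreover have "J y x + 1 = w" using dim_antipodal[OF x y(1)] y(2) du J_sym[of y x] by simp
  ultimately have "v \<in> Yp" using Yp_antipodal_convex[OF x y(1) _ v(1)] by blast
  then have "pole u v" using pole_nbr[OF Suc.prems v(1)] by blast
  moreover have "k = J v z" using Suc.hyps(2) v(2) by simp
  ultimately show ?case using Suc.hyps(1) by blast
qed

end

lemma width_ge_2_supset:
  "\<exists>u. isotropic B u \<and> vec.dim u = dual_width (hem_verts B) (hem_adj d B) E Y \<and>
       Y = {(x, s) | x s. x \<in> verts \<and> u \<subseteq> x}"
proof -
  obtain x where x: "x \<in> Yp" using Y_ne in_Y_iff by auto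
  obtain y where y: "y \<in> Yp" "J x y + 1 = w" by (rule antipode[OF x])
  define u where "u = x \<inter> y"
  have V: "x \<in> verts" "y \<in> verts" using x y Yp_verts by auto
  have du: "vec.dim u + w = d" using dim_antipodal[OF x y(1)] y(2) by (simp add: u_def)
  have su: "vec.subspace u" unfolding u_def by (rule inter_subspace[OF V])
  have P: "pole u x" using x y by (auto simp: pole_def u_def)
  have "z \<in> Yp \<longleftrightarrow> z \<in> verts \<and> u \<subseteq> z" for z
    using pole_all[OF du su _ P, of z] pole_supset[OF du su _ _ P, of z] Yp_verts[of z]
    by (auto simp: pole_def)
  then have "Y = {(x, s) | x s. x \<in> verts \<and> u \<subseteq> x}" using in_Y_iff by auto
  moreover have "isotropic B u" using su verts_orth[OF V(1)] by (auto simp: isotropic_def u_def)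
  moreover have "vec.dim u = dual_width (hem_verts B) (hem_adj d B) E Y" using du w_dual by linarith
  ultimately show ?thesis by blast
qed

end

end

theorem mainTheorem12:
  fixes B :: "'a::{field,finite} ^ 'n \<Rightarrow> 'a ^ 'n \<Rightarrow> 'a"
    and d q :: nat
    and E :: "nat \<Rightarrow> (('a ^ 'n) set \<times> bool) cmat"
    and Y :: "(('a ^ 'n) set \<times> bool) set"
  assumes "d \<ge> 3"
    and "CARD('a) = q" and "odd q"
    and "CARD('n) = 2 * d - 2"
    and "symplectic_form B"
    and "standard_ordering (hem_verts B) (hem_adj d B) d (real q) 0 1 E"
    and "nontrivial_descendent (hem_verts B) (hem_adj d B) E Y"
  shows "(graph_width (hem_verts B) (hem_adj d B) Y = 1 \<longrightarrow>
            (\<exists>p r. hem_adj d B p r \<and> Y = {p, r})) \<and>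
         (graph_width (hem_verts B) (hem_adj d B) Y > 1 \<longrightarrow>
            (\<exists>u. isotropic B u \<and>
                 vec.dim u = dual_width (hem_verts B) (hem_adj d B) E Y \<and>
                 Y = {(x, s) | x s. x \<in> dual_polar_verts B \<and> u \<subseteq> x}))"
proof -
  have two: "(2 :: 'a) \<noteq> 0" using assms(2,3) by (intro two_neq_zero_if_odd_card) simp
  have "card {0, 1 :: 'a} \<le> CARD('a)" by (intro card_mono) auto
  then have "q \<ge> 2" using assms(2) by simp
  moreover have "q \<noteq> 2" using assms(3) by auto
  ultimately have q3: "q \<ge> 3" by linarith
  then have q1: "real q > 1" by simp
  obtain b c \<theta> \<xi> \<zeta> where C: "classical01 (hem_verts B) (hem_adj d B) b c E \<theta> d (real q) \<xi> \<zeta>"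
    by (rule standard_ordering_classical01[OF assms(6) q1])
  interpret C: classical01 "hem_verts B" "hem_adj d B" b c E \<theta> d "real q" \<xi> \<zeta> by (rule C)
  \<comment> \<open>The ambient dimension \<open>2 * d - 2\<close> is \<open>2 * (d - 1)\<close>, so
    maximal isotropic subspaces have dimension \<open>d - 1\<close>.\<close>
  interpret hemmeter_descendent B "d - 1" d b c E \<theta> "real q" \<xi> \<zeta> Y
    by unfold_locales (use assms two q3 in \<open>auto simp: nontrivial_descendent_def\<close>)
  show ?thesis using width_one_edge width_ge_2_supset by simp
qed

end
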